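(* Let $\eta,\theta$ be two inner functions and let $X:\eta H^2\to K_\theta$ be a bounded linear operator. Then $X$ is a restricted Toeplitz operator (i.e. $X=\mathcal{T}_\phi$ for some $\phi\in L^\infty$) if and only if there is some $\phi\in L^\infty$ such that $$X-S_\theta^*X\mathcal{S}_{(\eta)}=S^*(\theta)\otimes P(\theta\,\overline{z\phi\eta}),$$ where the right-hand side is understood through the identification $\eta f\leftrightarrow f$ of $\eta H^2$ with $H^2$, that is, $$X(\eta f)-S_\theta^*X\mathcal{S}_{(\eta)}(\eta f)=\langle f,P(\theta\,\overline{z\phi\eta})\rangle\,S^*(\theta)\qquad\text{for all } f\in H^2 .$$ Moreover, if this identity holds for $\phi\in L^\infty$, then $X=\mathcal{T}_\phi$.
   Context: $H^2$ is the Hardy space, viewed as a closed subspace of $L^2=L^2(\mathbb{T})$ (normalized Lebesgue measure); $P:L^2\to H^2$ is the orthogonal projection; $L^\infty=L^\infty(\mathbb{T})$. For an inner function $\theta$, $K_\theta=H^2\ominus\theta H^2$ is the model space and $P_\theta:L^2\to K_\theta$ the orthogonal projection. $S$ is the shift $Sf=zf$ on $H^2$, $S^*$ its adjoint; $S_\theta=P_\theta S|_{K_\theta}$; $\mathcal{S}_{(\eta)}=P_{\eta H^2}S|_{\eta H^2}$, i.e. multiplication by $z$ on $\eta H^2$. For $\phi\in L^\infty$ and inner functions $\eta,\theta$, the restricted Toeplitz operator is $\mathcal{T}_\phi:\eta H^2\to K_\theta$, $\mathcal{T}_\phi(h)=P_\theta(\phi h)$. For vectors $u,v$, $(u\otimes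 v)(x)=\langle x,v\rangle u$. *)

theory Defs
  imports "HOL-Probability.Probability_Measure"
begin

section \<open>The Hilbert space of square-integrable functions on the unit circle\<close>

text \<open>Normalized Lebesgue measure on the unit circle, as a Borel measure on the complex plane
  concentrated on the circle. Almost-everywhere equality thus ignores all values off the circle.\<close>

definition circle_measure :: "complex measure" where
  "circle_measure = distr (uniform_measure lborel {0..<2 * pi}) borel cis"

definition square_integrable :: "(complex \<Rightarrow> complex) \<Rightarrow> bool" where
  "square_integrable f \<longleftrightarrow>
     f \<in> borel_measurable circle_measure \<and> integrable circle_measure (\<lambda>z. (cmod (f z))\<^sup>2)"

definition L2_rel :: "(complex \<Rightarrow> complex) \<Rightarrow> (complex \<Rightarrow> complex) \<Rightarrow> bool" where
  "L2_rel f g \<longleftrightarrow>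
     square_integrable f \<and> square_integrable g \<and> (AE z in circle_measure. f z = g z)"

lemma cis_borel_measurable [measurable]: "cis \<in> borel_measurable borel"
  by (intro borel_measurable_continuous_onI continuous_intros)

lemma cnj_borel_measurable [measurable]: "cnj \<in> borel_measurable borel"
  by (intro borel_measurable_continuous_onI continuous_intros)

lemma sets_circle_measure [simp, measurable_cong]: "sets circle_measure = sets borel"
  by (simp add: circle_measure_def)

lemma space_circle_measure [simp]: "space circle_measure = UNIV"
  by (simp add: circle_measure_def)

lemma prob_space_circle_measure: "prob_space circle_measure"
  unfolding circle_measure_def
  by (intro prob_space.prob_space_distr prob_space_uniform_measure)
    (auto simp: measurable_cong_sets[OF sets_uniform_measure refl])

lemma finite_measure_circle_measure: "finite_measure circle_measure"
  by (rule prob_space.finite_measure[OF prob_space_circle_measure])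

lemma AE_circle_measure_norm: "AE z in circle_measure. cmod z = 1"
  unfolding circle_measure_def by (subst AE_distr_iff) (auto simp: measurable_cong_sets[OF sets_uniform_measure refl])

lemma square_integrable_zero: "square_integrable (\<lambda>_. 0)"
  by (simp add: square_integrable_def)

lemma square_integrable_scale:
  assumes "square_integrable f"
  shows "square_integrable (\<lambda>z. c * f z)"
  using assms by (auto simp: square_integrable_def norm_mult power_mult_distrib)

lemma square_integrable_cnj:
  assumes "square_integrable f"
  shows "square_integrable (\<lambda>z. cnj (f z))"
  using assms by (auto simp: square_integrable_def)

lemma square_integrable_add:
  assumes "square_integrable f" "square_integrable g"
  shows "square_integrable (\<lambda>z. f z + g z)"
proof -
  have [measurable]: "f \<in> borel_measurable circle_measure" "g \<in> borel_measurable circle_measure"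
    using assms by (auto simp: square_integrable_def)
  have "(cmod (f z + g z))\<^sup>2 \<le> 2 * (cmod (f z))\<^sup>2 + 2 * (cmod (g z))\<^sup>2" for z
  proof -
    have "(cmod (f z + g z))\<^sup>2 \<le> (cmod (f z) + cmod (g z))\<^sup>2"
      by (intro power_mono norm_triangle_ineq) auto
    also have "\<dots> \<le> 2 * (cmod (f z))\<^sup>2 + 2 * (cmod (g z))\<^sup>2"
      using sum_squares_bound[of "cmod (f z)" "cmod (g z)"]
      by (simp add: power2_sum)
    finally show ?thesis .
  qed
  note bound = this
  have dom: "integrable circle_measure (\<lambda>z. 2 * (cmod (f z))\<^sup>2 + 2 * (cmod (g z))\<^sup>2)"
    using assms by (auto simp: square_integrable_def)
  have "integrable circle_measure (\<lambda>z. (cmod (f z + g z))\<^sup>2)"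
    by (rule Bochner_Integration.integrable_bound[OF dom]) (auto intro!: AE_I2 bound)
  then show ?thesis by (simp add: square_integrable_def)
qed

lemma square_integrable_product:
  assumes "square_integrable f" "square_integrable g"
  shows "integrable circle_measure (\<lambda>z. f z * cnj (g z))"
proof -
  have [measurable]: "f \<in> borel_measurable circle_measure" "g \<in> borel_measurable circle_measure"
    using assms by (auto simp: square_integrable_def)
  have "cmod (f z) * cmod (g z) \<le> (cmod (f z))\<^sup>2 + (cmod (g z))\<^sup>2" for z
  proof -
    have "2 * (cmod (f z) * cmod (g z)) \<le> (cmod (f z))\<^sup>2 + (cmod (g z))\<^sup>2"
      using sum_squares_bound[of "cmod (f z)" "cmod (g z)"] by simp
    moreover have "0 \<le> cmod (f z) * cmod (g z)" by simp
    ultimately show ?thesis by linarith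
  qed
  note bound = this
  have dom: "integrable circle_measure (\<lambda>z. (cmod (f z))\<^sup>2 + (cmod (g z))\<^sup>2)"
    using assms by (auto simp: square_integrable_def)
  show ?thesis
    by (rule Bochner_Integration.integrable_bound[OF dom])
      (auto simp: norm_mult intro!: AE_I2 bound)
qed

lemma square_integrable_powi: "square_integrable (\<lambda>z. z powi n)"
proof -
  have [measurable]: "(\<lambda>z::complex. z powi n) \<in> borel_measurable borel"
    unfolding power_int_def by (cases "0 \<le> n") auto
  interpret finite_measure circle_measure by (rule finite_measure_circle_measure)
  have "AE z in circle_measure. norm ((cmod (z powi n))\<^sup>2) \<le> 1"
    using AE_circle_measure_norm by eventually_elim (simp add: norm_power_int)
  then have "integrable circle_measure (\<lambda>z. (cmod (z powi n))\<^sup>2)"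
    by (intro integrable_const_bound) auto
  then show ?thesis by (simp add: square_integrable_def)
qed

quotient_type L2 = "complex \<Rightarrow> complex" / partial: L2_rel
proof (rule part_equivpI)
  show "\<exists>f. L2_rel f f"
    by (rule exI[of _ "\<lambda>_. 0"]) (simp add: L2_rel_def square_integrable_zero)
  show "symp L2_rel"
    unfolding symp_def L2_rel_def by (auto elim: eventually_mono)
  show "transp L2_rel"
    unfolding transp_def L2_rel_def by (auto elim: eventually_elim2)
qed

text \<open>The inner product is linear in the first and conjugate-linear in the second argument.\<close>

lift_definition cinner :: "L2 \<Rightarrow> L2 \<Rightarrow> complex" is
  "\<lambda>f g. integral\<^sup>L circle_measure (\<lambda>z. f z * cnj (g z))"
proof -
  fix f f' g g' assume "L2_rel f f'" "L2_rel g g'"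
  then have m: "f \<in> borel_measurable circle_measure" "f' \<in> borel_measurable circle_measure"
      "g \<in> borel_measurable circle_measure" "g' \<in> borel_measurable circle_measure"
    and ae: "AE z in circle_measure. f z = f' z" "AE z in circle_measure. g z = g' z"
    by (auto simp: L2_rel_def square_integrable_def)
  show "(LINT z|circle_measure. f z * cnj (g z)) = (LINT z|circle_measure. f' z * cnj (g' z))"
  proof (rule integral_cong_AE)
    show "AE z in circle_measure. f z * cnj (g z) = f' z * cnj (g' z)"
      using ae by eventually_elim simp
  qed (use m in auto)
qed

lift_definition scaleC :: "complex \<Rightarrow> L2 \<Rightarrow> L2" (infixr "*\<^sub>C" 75) is "\<lambda>c f z. c * f z"
  unfolding L2_rel_def by (auto intro: square_integrable_scale elim: eventually_mono)

text \<open>Pointwise product. The junk value 0 occurs only if the product is not square-integrable,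
  in particular never if one of the factors is essentially bounded.\<close>

lift_definition mult_L2 :: "L2 \<Rightarrow> L2 \<Rightarrow> L2" (infixl "\<odot>" 70) is
  "\<lambda>f g. if square_integrable (\<lambda>z. f z * g z) then (\<lambda>z. f z * g z) else (\<lambda>_. 0)"
proof -
  fix f f' g g' assume r: "L2_rel f f'" "L2_rel g g'"
  then have m [measurable]:
      "f \<in> borel_measurable circle_measure" "f' \<in> borel_measurable circle_measure"
      "g \<in> borel_measurable circle_measure" "g' \<in> borel_measurable circle_measure"
    and ae: "AE z in circle_measure. f z = f' z" "AE z in circle_measure. g z = g' z"
    by (auto simp: L2_rel_def square_integrable_def)
  have *: "AE z in circle_measure. f z * g z = f' z * g' z"
    using ae by eventually_elim simp
  have "integrable circle_measure (\<lambda>z. (cmod (f z * g z))\<^sup>2) \<longleftrightarrow>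
        integrable circle_measure (\<lambda>z. (cmod (f' z * g' z))\<^sup>2)"
  proof (rule integrable_cong_AE)
    show "AE z in circle_measure. (cmod (f z * g z))\<^sup>2 = (cmod (f' z * g' z))\<^sup>2"
      using * by eventually_elim simp
  qed auto
  then have "square_integrable (\<lambda>z. f z * g z) \<longleftrightarrow> square_integrable (\<lambda>z. f' z * g' z)"
    by (simp add: square_integrable_def)
  then show "L2_rel (if square_integrable (\<lambda>z. f z * g z) then (\<lambda>z. f z * g z) else (\<lambda>_. 0))
     (if square_integrable (\<lambda>z. f' z * g' z) then (\<lambda>z. f' z * g' z) else (\<lambda>_. 0))"
    using * by (auto simp: L2_rel_def square_integrable_zero)
qed

lift_definition conj_L2 :: "L2 \<Rightarrow> L2" is "\<lambda>f z. cnj (f z)"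
  unfolding L2_rel_def by (auto intro: square_integrable_cnj elim: eventually_mono)

lift_definition zpow :: "int \<Rightarrow> L2" is "\<lambda>n z. z powi n"
  by (simp add: L2_rel_def square_integrable_powi)

abbreviation zvar :: L2 where "zvar \<equiv> zpow 1"

instantiation L2 :: real_inner
begin

lift_definition zero_L2 :: L2 is "\<lambda>_. 0"
  by (simp add: L2_rel_def square_integrable_zero)

lift_definition plus_L2 :: "L2 \<Rightarrow> L2 \<Rightarrow> L2" is "\<lambda>f g z. f z + g z"
proof -
  fix f f' g g' assume "L2_rel f f'" "L2_rel g g'"
  then have s: "square_integrable (\<lambda>z. f z + g z)" "square_integrable (\<lambda>z. f' z + g' z)"
    and ae: "AE z in circle_measure. f z = f' z" "AE z in circle_measure. g z = g' z"
    by (auto simp: L2_rel_def intro: square_integrable_add)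
  have "AE z in circle_measure. f z + g z = f' z + g' z"
    using ae by eventually_elim simp
  with s show "L2_rel (\<lambda>z. f z + g z) (\<lambda>z. f' z + g' z)" by (simp add: L2_rel_def)
qed

definition uminus_L2 :: "L2 \<Rightarrow> L2" where "uminus_L2 f = (-1) *\<^sub>C f"

definition minus_L2 :: "L2 \<Rightarrow> L2 \<Rightarrow> L2" where "minus_L2 f g = f + (- g)"

definition scaleR_L2 :: "real \<Rightarrow> L2 \<Rightarrow> L2" where "scaleR_L2 r f = of_real r *\<^sub>C f"

definition inner_L2 :: "L2 \<Rightarrow> L2 \<Rightarrow> real" where "inner_L2 f g = Re (cinner f g)"

definition norm_L2 :: "L2 \<Rightarrow> real" where "norm_L2 f = sqrt (inner f f)"

definition sgn_L2 :: "L2 \<Rightarrow> L2" where "sgn_L2 f = inverse (norm f) *\<^sub>R f"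

definition dist_L2 :: "L2 \<Rightarrow> L2 \<Rightarrow> real" where "dist_L2 f g = norm (f - g)"

definition uniformity_L2 :: "(L2 \<times> L2) filter" where
  "uniformity_L2 = (INF e\<in>{0<..}. principal {(x, y). dist x y < e})"

definition open_L2 :: "L2 set \<Rightarrow> bool" where
  "open_L2 U \<longleftrightarrow> (\<forall>x\<in>U. \<forall>\<^sub>F (x', y) in uniformity. x' = x \<longrightarrow> y \<in> U)"

instance
proof
  fix f g h :: L2 and r s :: real
  show "f + g + h = f + (g + h)"
    by transfer (auto simp: L2_rel_def add.assoc intro!: square_integrable_add)
  show "f + g = g + f"
    by transfer (auto simp: L2_rel_def add.commute intro!: square_integrable_add)
  show "0 + f = f"
    by transfer (auto simp: L2_rel_def)
  show "- f + f = 0"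
    unfolding uminus_L2_def
    by transfer (auto simp: L2_rel_def square_integrable_zero)
  show "f - g = f + - g" by (simp add: minus_L2_def)
  show "r *\<^sub>R (f + g) = r *\<^sub>R f + r *\<^sub>R g"
    unfolding scaleR_L2_def
    by transfer (auto simp: L2_rel_def distrib_left
          intro!: square_integrable_add square_integrable_scale)
  show "(r + s) *\<^sub>R f = r *\<^sub>R f + s *\<^sub>R f"
    unfolding scaleR_L2_def
    by transfer (auto simp: L2_rel_def distrib_right
          intro!: square_integrable_add square_integrable_scale)
  show "r *\<^sub>R s *\<^sub>R f = (r * s) *\<^sub>R f"
    unfolding scaleR_L2_def
    by transfer (auto simp: L2_rel_def mult.assoc intro!: square_integrable_scale)
  show "1 *\<^sub>R f = f"
    unfolding scaleR_L2_def by transfer (auto simp: L2_rel_def)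
  show "dist f g = norm (f - g)" by (simp add: dist_L2_def)
  show "sgn f = inverse (norm f) *\<^sub>R f" by (simp add: sgn_L2_def)
  show "norm f = sqrt (inner f f)" by (simp add: norm_L2_def)
  show "inner f g = inner g f"
    unfolding inner_L2_def
  proof transfer
    fix f g :: "complex \<Rightarrow> complex"
    have "(LINT z|circle_measure. g z * cnj (f z)) = cnj (LINT z|circle_measure. f z * cnj (g z))"
      by (simp add: mult.commute flip: Bochner_Integration.integral_cnj)
    then show "Re (LINT z|circle_measure. f z * cnj (g z)) =
        Re (LINT z|circle_measure. g z * cnj (f z))" by simp
  qed
  show "inner (f + g) h = inner f h + inner g h"
    unfolding inner_L2_def
    by transfer
      (simp add: L2_rel_def distrib_right square_integrable_product Bochner_Integration.integral_add)
  show "inner (r *\<^sub>R f) g = r * inner f g"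
    unfolding inner_L2_def scaleR_L2_def by transfer (simp add: mult.assoc)
  have sq: "Re (LINT z|circle_measure. f z * cnj (f z)) = (LINT z|circle_measure. (cmod (f z))\<^sup>2)"
    for f by (simp add: complex_norm_square[symmetric] del: of_real_power)
  show "0 \<le> inner f f"
    unfolding inner_L2_def by transfer (simp add: sq)
  show "inner f f = 0 \<longleftrightarrow> f = 0"
    unfolding inner_L2_def
    by transfer (auto simp: sq L2_rel_def square_integrable_zero square_integrable_def
          integral_nonneg_eq_0_iff_AE)
qed (simp_all only: uniformity_L2_def open_L2_def)

end

section \<open>Bounded functions, Hardy space, inner functions, model spaces\<close>

lift_definition ess_bounded :: "L2 \<Rightarrow> bool" is
  "\<lambda>f. \<exists>C. AE z in circle_measure. cmod (f z) \<le> C"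
proof -
  fix f g assume "L2_rel f g"
  then have ae: "AE z in circle_measure. f z = g z" by (simp add: L2_rel_def)
  have "(AE z in circle_measure. cmod (f z) \<le> C) \<longleftrightarrow> (AE z in circle_measure. cmod (g z) \<le> C)" for C
    using ae by (intro eventually_subst) (auto elim: eventually_mono)
  then show "(\<exists>C. AE z in circle_measure. cmod (f z) \<le> C) \<longleftrightarrow>
      (\<exists>C. AE z in circle_measure. cmod (g z) \<le> C)" by simp
qed

lift_definition unimodular :: "L2 \<Rightarrow> bool" is "\<lambda>f. AE z in circle_measure. cmod (f z) = 1"
proof -
  fix f g assume "L2_rel f g"
  then have ae: "AE z in circle_measure. f z = g z" by (simp add: L2_rel_def)
  then show "(AE z in circle_measure. cmod (f z) = 1) \<longleftrightarrow> (AE z in circle_measure. cmod (g z) = 1)"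
    by (intro eventually_subst) (auto elim: eventually_mono)
qed

definition Linf :: "L2 set" where
  "Linf = {f. ess_bounded f}"

text \<open>The closed subspace of functions whose Fourier coefficients of negative index vanish.\<close>

definition H2 :: "L2 set" where
  "H2 = {f. \<forall>n<0. cinner f (zpow n) = 0}"

text \<open>Inner functions are identified with their boundary values.\<close>

definition inner_function :: "L2 \<Rightarrow> bool" where
  "inner_function \<theta> \<longleftrightarrow> \<theta> \<in> H2 \<and> unimodular \<theta>"

definition model_space :: "L2 \<Rightarrow> L2 set" where
  "model_space \<theta> = {f \<in> H2. \<forall>g \<in> (\<odot>) \<theta> ` H2. cinner f g = 0}"

section \<open>Operators\<close>

text \<open>Operators between subspaces of the whole space are maps on the whole space of which only the
  values on the domain matter.\<close>

definition bounded_operator :: "L2 set \<Rightarrow> L2 set \<Rightarrow> (L2 \<Rightarrow> L2) \<Rightarrow> bool" where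
  "bounded_operator V W A \<longleftrightarrow>
     (\<forall>x\<in>V. A x \<in> W) \<and>
     (\<forall>x\<in>V. \<forall>y\<in>V. A (x + y) = A x + A y) \<and>
     (\<forall>c. \<forall>x\<in>V. A (c *\<^sub>C x) = c *\<^sub>C A x) \<and>
     (\<exists>C. \<forall>x\<in>V. norm (A x) \<le> C * norm x)"

definition orth_proj :: "L2 set \<Rightarrow> L2 \<Rightarrow> L2" where
  "orth_proj V x = (THE y. y \<in> V \<and> (\<forall>v\<in>V. cinner (x - y) v = 0))"

text \<open>The Hilbert space adjoint, mapping \<open>W\<close> to \<open>V\<close>, of an operator from \<open>V\<close> to \<open>W\<close>.\<close>

definition adjoint_op :: "L2 set \<Rightarrow> L2 set \<Rightarrow> (L2 \<Rightarrow> L2) \<Rightarrow> L2 \<Rightarrow> L2" where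
  "adjoint_op V W A y = (THE x. x \<in> V \<and> (\<forall>v\<in>V. cinner (A v) y = cinner v x))"

definition rank_one :: "L2 \<Rightarrow> L2 \<Rightarrow> L2 \<Rightarrow> L2" where
  "rank_one u v x = cinner x v *\<^sub>C u"

definition shift :: "L2 \<Rightarrow> L2" where
  "shift f = zvar \<odot> f"

definition backward_shift :: "L2 \<Rightarrow> L2" where
  "backward_shift = adjoint_op H2 H2 shift"

definition model_shift :: "L2 \<Rightarrow> L2 \<Rightarrow> L2" where
  "model_shift \<theta> f = orth_proj (model_space \<theta>) (shift f)"

definition model_shift_adj :: "L2 \<Rightarrow> L2 \<Rightarrow> L2" where
  "model_shift_adj \<theta> = adjoint_op (model_space \<theta>) (model_space \<theta>) (model_shift \<theta>)"

definition restricted_shift :: "L2 \<Rightarrow> L2 \<Rightarrow> L2" where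
  "restricted_shift \<eta> h = orth_proj ((\<odot>) \<eta> ` H2) (shift h)"

definition restricted_toeplitz :: "L2 \<Rightarrow> L2 \<Rightarrow> L2 \<Rightarrow> L2" where
  "restricted_toeplitz \<theta> \<phi> h = orth_proj (model_space \<theta>) (\<phi> \<odot> h)"

text \<open>The identity between operators on \<open>\<eta>H\<^sup>2\<close>, whose right-hand side, an operator on \<open>H\<^sup>2\<close>, is
  transported along \<open>\<eta>f \<leftrightarrow> f\<close>.\<close>

definition displacement_identity :: "L2 \<Rightarrow> L2 \<Rightarrow> (L2 \<Rightarrow> L2) \<Rightarrow> L2 \<Rightarrow> bool" where
  "displacement_identity \<eta> \<theta> X \<phi> \<longleftrightarrow>
     (\<forall>f\<in>H2. X (\<eta> \<odot> f) - model_shift_adj \<theta> (X (restricted_shift \<eta> (\<eta> \<odot> f))) =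
        rank_one (backward_shift \<theta>) (orth_proj H2 (\<theta> \<odot> conj_L2 (zvar \<odot> \<phi> \<odot> \<eta>))) f)"

end

(*
  For g in L^2, P_theta = P - theta P conj(theta) gives
    P_theta(g) - S^* P_theta(z g) = <z g, theta> S^*(theta),
  so T_phi satisfies the identity with its own symbol.  Conversely, if X satisfies it with phi, then
  A f = (X - T_phi)(eta f) satisfies A = S^* A S, i.e. A is a Toeplitz operator on H^2 with range in
  K_theta.  Since <A f, g> = <A(z^n f), z^n g> and z^n g is at distance tending to 0 from theta H^2,
  A vanishes.  That theta H^2 is contained in H^2 and that P exists rest on the completeness of L^2
  and of the trigonometric system.
*)

theory Submission
  imports Defs
begin

section \<open>Multiplication operators on \<open>L\<^sup>2\<close>\<close>

text \<open>\<open>orth_proj\<close> and \<open>adjoint_op\<close> are definite descriptions, so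
  every use needs an explicit candidate. P is obtained by subtracting the negative Fourier part, a
  series that converges by Bessel's inequality once \<open>L2\<close> is complete; the projection
  onto the model space and the adjoints are then written in terms of P. An inner function is given
  only by its boundary values and \<open>H2\<close> only by Fourier coefficients, so the inclusion
  of \<theta>H^2 in H^2 amounts to density of the analytic polynomials in \<open>H2\<close>; this is
  where completeness of the trigonometric system enters. The rank-one term has a single source:
  P(zx) and zP(x) differ by a constant, the coefficient of x at index -1. For x = conj(\<theta>) g
  this constant gets multiplied by \<theta> and then mapped by S^*. In the converse, z^n g =
  \<theta> (z^n conj(\<theta>) g), and z^n conj(\<theta>) g is nearly in H^2 for suitable n because
  the spaces z^(-n) H^2 exhaust L^2. Boundedness of X makes the remaining pairing small.\<close>

lemma square_integrable_bounded_mult: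
  assumes "square_integrable f" "a \<in> borel_measurable circle_measure"
    and "AE z in circle_measure. cmod (a z) \<le> C"
  shows "square_integrable (\<lambda>z. a z * f z)"
proof -
  have [measurable]: "f \<in> borel_measurable circle_measure" "a \<in> borel_measurable circle_measure"
    using assms by (auto simp: square_integrable_def)
  have "integrable circle_measure (\<lambda>z. (cmod (a z * f z))\<^sup>2)"
  proof (rule Bochner_Integration.integrable_bound)
    show "integrable circle_measure (\<lambda>z. C\<^sup>2 * (cmod (f z))\<^sup>2)"
      using assms(1) by (simp add: square_integrable_def)
    show "AE z in circle_measure. norm ((cmod (a z * f z))\<^sup>2) \<le> norm (C\<^sup>2 * (cmod (f z))\<^sup>2)"
      using assms(3)
    proof eventually_elim
      case (elim z)
      then show ?case
        by (simp add: norm_mult power_mult_distrib mult_right_mono power_mono)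
    qed
  qed simp
  then show ?thesis by (simp add: square_integrable_def)
qed

section \<open>The complex inner product\<close>

lemma cinner_commute: "cinner g f = cnj (cinner f g)"
  by transfer (simp add: mult.commute flip: Bochner_Integration.integral_cnj)

lemma cinner_add_left: "cinner (f + g) h = cinner f h + cinner g h"
  by transfer
    (simp add: L2_rel_def distrib_right square_integrable_product Bochner_Integration.integral_add)

lemma cinner_scaleC_left [simp]: "cinner (c *\<^sub>C f) g = c * cinner f g"
  by transfer (simp add: mult.assoc)

lemma cinner_scaleC_right [simp]: "cinner f (c *\<^sub>C g) = cnj c * cinner f g"
  by (metis cinner_commute cinner_scaleC_left complex_cnj_mult complex_cnj_cnj)

lemma cinner_add_right: "cinner f (g + h) = cinner f g + cinner f h"
  by (metis cinner_commute cinner_add_left complex_cnj_add)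

lemma cinner_diff_left: "cinner (f - g) h = cinner f h - cinner g h"
  by (simp add: minus_L2_def uminus_L2_def cinner_add_left)

lemma cinner_diff_right: "cinner f (g - h) = cinner f g - cinner f h"
  by (simp add: minus_L2_def uminus_L2_def cinner_add_right)

lemma cinner_zero_left [simp]: "cinner 0 f = 0"
  using cinner_diff_left[of f f f] by simp

lemma cinner_zero_right [simp]: "cinner f 0 = 0"
  using cinner_diff_right[of f f f] by simp

lemma cinner_self: "cinner f f = complex_of_real ((norm f)\<^sup>2)"
proof -
  have "Im (cinner f f) = 0" using cinner_commute[of f f] by (simp add: complex_eq_iff)
  moreover have "Re (cinner f f) = (norm f)\<^sup>2"
    by (simp add: power2_norm_eq_inner inner_L2_def)
  ultimately show ?thesis by (simp add: complex_eq_iff)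
qed

lemma norm_scaleC: "norm (c *\<^sub>C f) = cmod c * norm f"
proof -
  have "complex_of_real ((norm (c *\<^sub>C f))\<^sup>2) = complex_of_real ((cmod c * norm f)\<^sup>2)"
    by (simp add: cinner_self[symmetric] power_mult_distrib complex_norm_square
        del: of_real_power)
  then have "(norm (c *\<^sub>C f))\<^sup>2 = (cmod c * norm f)\<^sup>2" using of_real_eq_iff by blast
  then show ?thesis by (simp add: power2_eq_iff_nonneg)
qed

text \<open>Real Cauchy-Schwarz controls only the real part of the pairing. Rotating
  \<open>f\<close> by the conjugate phase makes the pairing equal to its modulus and leaves the norm
  of \<open>f\<close> unchanged.\<close>

lemma norm_cinner_le: "cmod (cinner f g) \<le> norm f * norm g"
proof (cases "cinner f g = 0")
  case False
  define c where "c = cnj (sgn (cinner f g))"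
  have c: "cmod c = 1" using False by (simp add: c_def norm_sgn)
  have "c * cinner f g = complex_of_real (cmod (cinner f g))"
  proof -
    have "c * cinner f g = cinner f g * cnj (cinner f g) / cmod (cinner f g)"
      by (simp add: c_def sgn_eq)
    also have "\<dots> = (complex_of_real (cmod (cinner f g)))\<^sup>2 / cmod (cinner f g)"
      by (simp only: complex_norm_square flip: of_real_power)
    finally show ?thesis using False by (simp add: power2_eq_square)
  qed
  then have "cmod (cinner f g) = inner (c *\<^sub>C f) g" by (simp add: inner_L2_def)
  also have "\<dots> \<le> norm (c *\<^sub>C f) * norm g" by (rule norm_cauchy_schwarz)
  finally show ?thesis by (simp add: norm_scaleC c)
qed simp

section \<open>Pointwise multiplication by bounded functions and powers of z\<close>

lemma mult_L2_commute: "f \<odot> g = g \<odot> f"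
  by transfer (auto simp: L2_rel_def mult.commute square_integrable_zero)

text \<open>Boundedness of the two left factors makes all four products square-integrable, so the
  default value 0 of the product never interferes.\<close>

lemma Linf_mult_assoc:
  assumes "a \<in> Linf" "b \<in> Linf"
  shows "a \<odot> (b \<odot> f) = a \<odot> b \<odot> f"
  using assms unfolding Linf_def mem_Collect_eq
  apply transfer
  subgoal premises p for a b f
  proof -
    from p obtain C D where C: "AE z in circle_measure. cmod (a z) \<le> C"
      and D: "AE z in circle_measure. cmod (b z) \<le> D" by blast
    have m: "a \<in> borel_measurable circle_measure" "b \<in> borel_measurable circle_measure"
      and s: "square_integrable f" "square_integrable b"
      using p by (auto simp: L2_rel_def square_integrable_def)
    show ?thesis
      using square_integrable_bounded_mult[OF square_integrable_bounded_mult[OF s(1) m(2) D] m(1) C]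
        square_integrable_bounded_mult[OF s(1) m(2) D] square_integrable_bounded_mult[OF s(2) m(1) C]
      by (simp add: L2_rel_def mult.assoc)
  qed
  done

lemma Linf_mult:
  assumes "a \<in> Linf" "b \<in> Linf"
  shows "a \<odot> b \<in> Linf"
  using assms unfolding Linf_def mem_Collect_eq
  apply transfer
  subgoal premises p for a b
  proof -
    from p obtain C D where C: "AE z in circle_measure. cmod (a z) \<le> C"
      and D: "AE z in circle_measure. cmod (b z) \<le> D" by blast
    have "AE z in circle_measure. cmod (a z * b z) \<le> C * D"
      using C D
    proof eventually_elim
      case (elim z)
      then show ?case
        using order_trans[OF norm_ge_zero elim(1)] by (simp add: norm_mult mult_mono)
    qed
    then have "\<exists>C. AE z in circle_measure. cmod (a z * b z) \<le> C" ..
    \<comment> \<open>Covers the default branch of the lifted product, so that no case distinction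
      on square-integrability is required.\<close>
    moreover have "\<exists>C. AE z in circle_measure. cmod (0 :: complex) \<le> C"
      by (rule exI[of _ 0]) simp
    ultimately show ?thesis by simp
  qed
  done

lemma Linf_conj: "a \<in> Linf \<Longrightarrow> conj_L2 a \<in> Linf"
  unfolding Linf_def mem_Collect_eq by transfer simp

lemma unimodular_imp_Linf: "unimodular u \<Longrightarrow> u \<in> Linf"
  unfolding Linf_def mem_Collect_eq
proof transfer
  fix u :: "complex \<Rightarrow> complex"
  assume "AE z in circle_measure. cmod (u z) = 1"
  then have "AE z in circle_measure. cmod (u z) \<le> 1" by eventually_elim simp
  then show "\<exists>C. AE z in circle_measure. cmod (u z) \<le> C" ..
qed

lemma unimodular_zpow: "unimodular (zpow n)"
proof transfer
  fix n :: int
  show "AE z in circle_measure. cmod (z powi n) = 1"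
    using AE_circle_measure_norm by eventually_elim (simp add: norm_power_int)
qed

lemma Linf_zpow: "zpow n \<in> Linf"
  by (intro unimodular_imp_Linf unimodular_zpow)

lemma Linf_mult_add:
  assumes "a \<in> Linf"
  shows "a \<odot> (f + g) = a \<odot> f + a \<odot> g"
  using assms unfolding Linf_def mem_Collect_eq
  apply transfer
  subgoal premises p for a f g
  proof -
    from p obtain C where C: "AE z in circle_measure. cmod (a z) \<le> C" by blast
    have m: "a \<in> borel_measurable circle_measure"
      and s: "square_integrable f" "square_integrable g"
      using p by (auto simp: L2_rel_def square_integrable_def)
    show ?thesis
      using square_integrable_bounded_mult[OF s(1) m C] square_integrable_bounded_mult[OF s(2) m C]
        square_integrable_bounded_mult[OF square_integrable_add[OF s] m C]
      by (simp add: L2_rel_def distrib_left)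
  qed
  done

lemma Linf_mult_scaleC:
  assumes "a \<in> Linf"
  shows "a \<odot> (c *\<^sub>C f) = c *\<^sub>C (a \<odot> f)"
  using assms unfolding Linf_def mem_Collect_eq
  apply transfer
  subgoal premises p for a c f
  proof -
    from p obtain C where C: "AE z in circle_measure. cmod (a z) \<le> C" by blast
    have m: "a \<in> borel_measurable circle_measure" and s: "square_integrable f"
      using p by (auto simp: L2_rel_def square_integrable_def)
    show ?thesis
      using square_integrable_bounded_mult[OF s m C]
        square_integrable_bounded_mult[OF square_integrable_scale[OF s] m C]
      by (simp add: L2_rel_def mult.left_commute)
  qed
  done

lemma Linf_mult_diff:
  assumes "a \<in> Linf"
  shows "a \<odot> (f - g) = a \<odot> f - a \<odot> g"
  using assms by (simp add: minus_L2_def uminus_L2_def Linf_mult_add Linf_mult_scaleC)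

lemma cinner_mult_left:
  assumes "a \<in> Linf"
  shows "cinner (a \<odot> f) g = cinner f (conj_L2 a \<odot> g)"
  using assms unfolding Linf_def mem_Collect_eq
  apply transfer
  subgoal premises p for a f g
  proof -
    from p obtain C where C: "AE z in circle_measure. cmod (a z) \<le> C" by blast
    then have C': "AE z in circle_measure. cmod (cnj (a z)) \<le> C" by simp
    have [measurable]: "a \<in> borel_measurable circle_measure"
      and s: "square_integrable f" "square_integrable g"
      using p by (auto simp: L2_rel_def square_integrable_def)
    have m: "(\<lambda>z. cnj (a z)) \<in> borel_measurable circle_measure" by measurable
    show ?thesis
      using square_integrable_bounded_mult[OF s(1) _ C]
        square_integrable_bounded_mult[OF s(2) m C']
      by (simp add: mult_ac)
  qed
  done

lemma conj_L2_conj_L2 [simp]: "conj_L2 (conj_L2 f) = f"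
  by transfer (simp add: L2_rel_def)

lemma cinner_mult_right: "a \<in> Linf \<Longrightarrow> cinner f (a \<odot> g) = cinner (conj_L2 a \<odot> f) g"
  using cinner_mult_left[OF Linf_conj, of a f g] by simp

lemma conj_zpow: "conj_L2 (zpow n) = zpow (- n)"
  apply transfer
  subgoal for n
  proof -
    have "AE z in circle_measure. cnj (z powi n) = z powi (- n)"
      using AE_circle_measure_norm
    proof eventually_elim
      case (elim z)
      then have "z * cnj z = 1" using complex_norm_square[of z] by simp
      then have "cnj z = inverse z" by (metis inverse_unique)
      then show ?case by (simp add: power_int_minus power_int_inverse)
    qed
    then show ?thesis
      using square_integrable_powi[of "- n"] square_integrable_cnj[OF square_integrable_powi[of n]]
      by (simp add: L2_rel_def)
  qed
  done

lemma zpow_0_mult [simp]: "zpow 0 \<odot> f = f"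
  by transfer (simp add: L2_rel_def)

text \<open>The pointwise law fails at the origin, where for instance \<open>z powi (-1) * z\<close>
  is 0. The origin is off the circle, so equality almost everywhere suffices.\<close>

lemma zpow_add: "zpow m \<odot> zpow n = zpow (m + n)"
  apply transfer
  subgoal for m n
  proof -
    have [measurable]: "(\<lambda>z::complex. z powi k) \<in> borel_measurable circle_measure" for k
      using square_integrable_powi[of k] by (simp add: square_integrable_def)
    have ae: "AE z in circle_measure. z powi m * z powi n = z powi (m + n)"
      using AE_circle_measure_norm
    proof eventually_elim
      case (elim z)
      then have "z \<noteq> 0" by auto
      then show ?case by (simp add: power_int_add)
    qed
    have "square_integrable (\<lambda>z. z powi m * z powi n)"
      using AE_circle_measure_norm
      by (intro square_integrable_bounded_mult[where C = 1] square_integrable_powi)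
        (auto elim!: eventually_mono simp: norm_power_int)
    with ae show ?thesis using square_integrable_powi by (simp add: L2_rel_def)
  qed
  done

text \<open>\<open>zpow 0\<close> plays the part of the constant function 1 in
  \<open>L2\<close>.\<close>

lemma unimodular_conj_mult: "unimodular u \<Longrightarrow> conj_L2 u \<odot> u = zpow 0"
  apply transfer
  subgoal premises p for u
  proof -
    have m [measurable]: "u \<in> borel_measurable circle_measure"
      and s: "square_integrable u" using p by (auto simp: L2_rel_def square_integrable_def)
    have "square_integrable (\<lambda>z. cnj (u z) * u z)"
      using p by (intro square_integrable_bounded_mult[where C = 1] s)
        (auto elim!: eventually_mono)
    moreover have "AE z in circle_measure. cnj (u z) * u z = 1"
      using p(2)
    proof eventually_elim
      case (elim z)
      then show ?case using complex_norm_square[of "u z"] by (simp add: mult.commute)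
    qed
    ultimately show ?thesis using square_integrable_powi[of 0] by (simp add: L2_rel_def)
  qed
  done

lemma unimodular_conj_mult_cancel: "unimodular u \<Longrightarrow> conj_L2 u \<odot> (u \<odot> f) = f"
  by (simp add: Linf_mult_assoc Linf_conj unimodular_imp_Linf unimodular_conj_mult)

lemma unimodular_mult_conj_cancel: "unimodular u \<Longrightarrow> u \<odot> (conj_L2 u \<odot> f) = f"
  using unimodular_imp_Linf[of u] Linf_conj[of u] unimodular_conj_mult[of u]
  by (simp add: Linf_mult_assoc mult_L2_commute[of u "conj_L2 u"])

lemma norm_unimodular_mult: "unimodular u \<Longrightarrow> norm (u \<odot> f) = norm f"
  by (simp add: norm_eq_sqrt_inner inner_L2_def cinner_mult_left unimodular_imp_Linf
      unimodular_conj_mult_cancel)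

lemma norm_L2_abs:
  assumes "square_integrable f"
  shows "(norm (abs_L2 f))\<^sup>2 = (LINT z|circle_measure. (cmod (f z))\<^sup>2)"
proof -
  have "cinner (abs_L2 f) (abs_L2 f) = (LINT z|circle_measure. f z * cnj (f z))"
    using assms by (intro cinner.abs_eq) (auto simp: L2_rel_def)
  then have "complex_of_real ((norm (abs_L2 f))\<^sup>2) = (LINT z|circle_measure. f z * cnj (f z))"
    by (simp add: cinner_self)
  also have "\<dots> = complex_of_real (LINT z|circle_measure. (cmod (f z))\<^sup>2)"
    by (simp add: complex_norm_square[symmetric] del: of_real_power)
  finally show ?thesis using of_real_eq_iff by blast
qed

lemma L2_abs_cases:
  obtains f where "square_integrable f" "x = abs_L2 f"
  using Quotient_rep_reflp[OF Quotient_L2, of x] Quotient_abs_rep[OF Quotient_L2, of x]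
  by (auto simp: L2_rel_def)

lemma Linf_mult_bounded:
  assumes "a \<in> Linf"
  obtains C where "\<And>f. norm (a \<odot> f) \<le> C * norm f"
proof -
  obtain \<alpha> where \<alpha>: "square_integrable \<alpha>" "a = abs_L2 \<alpha>" by (rule L2_abs_cases)
  then have m: "\<alpha> \<in> borel_measurable circle_measure" by (simp add: square_integrable_def)
  have "ess_bounded (abs_L2 \<alpha>) = (\<exists>C. AE z in circle_measure. cmod (\<alpha> z) \<le> C)"
    using \<alpha> by (intro ess_bounded.abs_eq) (simp add: L2_rel_def)
  then obtain C where C: "AE z in circle_measure. cmod (\<alpha> z) \<le> C"
    using assms \<alpha> by (auto simp: Linf_def)
  have "norm (a \<odot> f) \<le> \<bar>C\<bar> * norm f" for f
  proof -
    obtain \<beta> where \<beta>: "square_integrable \<beta>" "f = abs_L2 \<beta>" by (rule L2_abs_cases)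
    have s: "square_integrable (\<lambda>z. \<alpha> z * \<beta> z)"
      by (rule square_integrable_bounded_mult[OF \<beta>(1) m C])
    have "a \<odot> f = abs_L2 (\<lambda>z. \<alpha> z * \<beta> z)"
      using s \<alpha> \<beta> mult_L2.abs_eq[of \<alpha> \<beta>] by (simp add: L2_rel_def)
    then have "(norm (a \<odot> f))\<^sup>2 = (LINT z|circle_measure. (cmod (\<alpha> z * \<beta> z))\<^sup>2)"
      using norm_L2_abs[OF s] by simp
    also have "\<dots> \<le> (LINT z|circle_measure. C\<^sup>2 * (cmod (\<beta> z))\<^sup>2)"
    proof (rule integral_mono_AE)
      show "AE z in circle_measure. (cmod (\<alpha> z * \<beta> z))\<^sup>2 \<le> C\<^sup>2 * (cmod (\<beta> z))\<^sup>2"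
        using C by eventually_elim (simp add: norm_mult power_mult_distrib mult_right_mono power_mono)
    qed (use s \<beta> in \<open>auto simp: square_integrable_def\<close>)
    also have "\<dots> = (\<bar>C\<bar> * norm f)\<^sup>2"
      using norm_L2_abs[OF \<beta>(1)] \<beta> by (simp add: power_mult_distrib)
    finally show ?thesis by (rule power2_le_imp_le) auto
  qed
  then show thesis using that by blast
qed

section \<open>Orthonormality of the powers and completeness of \<open>L\<^sup>2\<close>\<close>

lemma borel_measurable_circle_measure [simp]:
  "borel_measurable circle_measure = borel_measurable borel"
  by (rule measurable_cong_sets) simp_all

lemma measure_circle_measure_UNIV [simp]: "measure circle_measure UNIV = 1"
  using prob_space.prob_space[OF prob_space_circle_measure] by simp

text \<open>The closed interval is the form in which the fundamental theorem of calculus is applied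
  below. The extra endpoint is a null set.\<close>

lemma integral_circle_measure:
  fixes f :: "complex \<Rightarrow> complex"
  assumes [measurable]: "f \<in> borel_measurable borel"
  shows "integral\<^sup>L circle_measure f =
    (LINT t|lborel. indicator {0..2 * pi} t *\<^sub>R (f (cis t) /\<^sub>R (2 * pi)))"
proof -
  have dens: "uniform_measure lborel {0..<2 * pi} =
      density lborel (\<lambda>t. ennreal (indicator {0..<2 * pi} t / (2 * pi)))"
    unfolding uniform_measure_def
    by (rule arg_cong[where f = "density lborel"])
      (auto simp: fun_eq_iff indicator_def divide_ennreal[symmetric] split: if_splits)
  have "integral\<^sup>L circle_measure f =
      (LINT t|uniform_measure lborel {0..<2 * pi}. f (cis t))"
    unfolding circle_measure_def by (subst integral_distr) auto
  also have "\<dots> = (LINT t|lborel. (indicator {0..<2 * pi} t / (2 * pi)) *\<^sub>R f (cis t))"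
    unfolding dens by (subst integral_density) auto
  also have "\<dots> = (LINT t|lborel. indicator {0..2 * pi} t *\<^sub>R (f (cis t) /\<^sub>R (2 * pi)))"
  proof (rule integral_cong_AE)
    show "AE t in lborel. (indicator {0..<2 * pi} t / (2 * pi)) *\<^sub>R f (cis t) =
        indicator {0..2 * pi} t *\<^sub>R (f (cis t) /\<^sub>R (2 * pi))"
      using AE_lborel_singleton[of "2 * pi"]
      by eventually_elim (auto simp: indicator_def field_simps)
  qed auto
  finally show ?thesis .
qed

lemma cinner_zpow_zero:
  assumes "k \<noteq> 0"
  shows "cinner (zpow k) (zpow 0) = 0"
proof -
  \<comment> \<open>The antiderivative of the integrand, which exists because \<open>k\<close> is
    nonzero; it takes the same value at 0 and at 2 pi.\<close>
  let ?F = "\<lambda>t. cis (of_int k * t) / (\<i> * of_int k * (2 * pi))"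
  have m: "(\<lambda>z::complex. z powi k) \<in> borel_measurable borel"
    using square_integrable_powi[of k] by (simp add: square_integrable_def)
  have "cinner (zpow k) (zpow 0) = integral\<^sup>L circle_measure (\<lambda>z. z powi k)"
    by transfer simp
  also have "\<dots> = (LINT t|lborel. indicator {0..2 * pi} t *\<^sub>R (cis (of_int k * t) /\<^sub>R (2 * pi)))"
    by (subst integral_circle_measure[OF m]) (simp add: cis_power_int)
  also have "\<dots> = ?F (2 * pi) - ?F 0"
  proof (rule integral_FTC_atLeastAtMost)
    fix t :: real
    show "(?F has_vector_derivative cis (of_int k * t) /\<^sub>R (2 * pi)) (at t within {0..2 * pi})"
    proof -
      have "((\<lambda>w. exp (\<i> * of_int k * w) / (\<i> * of_int k * (2 * pi)))
          has_field_derivative exp (\<i> * of_int k * of_real t) / (2 * pi)) (at (of_real t))"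
        using assms by (auto intro!: derivative_eq_intros)
      from has_vector_derivative_real_field[OF this] show ?thesis
        by (simp add: cis_conv_exp scaleR_conv_of_real mult.assoc field_simps)
    qed
  qed (auto intro!: continuous_intros)
  also have "cis (of_int k * (2 * pi)) = 1"
    using cis_multiple_2pi[of "of_int k"] by (simp add: mult.commute)
  finally show ?thesis by simp
qed

lemma cinner_zpow: "cinner (zpow m) (zpow n) = (if m = n then 1 else 0)"
proof -
  have "cinner (zpow m) (zpow n) = cinner (zpow (m - n)) (zpow 0)"
    using cinner_mult_right[OF Linf_zpow, of "zpow m" n "zpow 0"]
    by (simp add: conj_zpow zpow_add)
  also have "\<dots> = (if m = n then 1 else 0)"
  proof (cases "m = n")
    case True
    have "cinner (zpow 0) (zpow 0) = 1" by transfer simp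
    with True show ?thesis by simp
  qed (simp add: cinner_zpow_zero)
  finally show ?thesis .
qed

section \<open>Completeness of the space of square-integrable functions\<close>

lemma integral_cmod_le_norm_L2:
  assumes "square_integrable f"
  shows "integrable circle_measure f" "(LINT z|circle_measure. cmod (f z)) \<le> norm (abs_L2 f)"
proof -
  have [measurable]: "f \<in> borel_measurable borel"
    and i: "integrable circle_measure (\<lambda>z. (cmod (f z))\<^sup>2)"
    using assms by (auto simp: square_integrable_def)
  interpret prob_space circle_measure by (rule prob_space_circle_measure)
  have "integrable circle_measure (\<lambda>z. cmod (f z))"
    by (rule square_integrable_imp_integrable) (use i in auto)
  then show int: "integrable circle_measure f" by (simp add: integrable_norm_iff)
  define c where "c = (LINT z|circle_measure. cmod (f z))"
  \<comment> \<open>The variance of |f| is nonnegative. Total mass 1 turns this into the bound of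
    the L^1 norm by the L^2 norm.\<close>
  have "0 \<le> (LINT z|circle_measure. (cmod (f z) - c)\<^sup>2)" by simp
  also have "\<dots> = (LINT z|circle_measure. (cmod (f z))\<^sup>2 - 2 * c * cmod (f z) + c\<^sup>2)"
    by (simp add: power2_diff algebra_simps)
  also have "\<dots> = (LINT z|circle_measure. (cmod (f z))\<^sup>2) - c\<^sup>2"
    using i int by (simp add: c_def[symmetric] power2_eq_square)
  finally have "c\<^sup>2 \<le> (norm (abs_L2 f))\<^sup>2" using norm_L2_abs[OF assms] by simp
  then show "c \<le> norm (abs_L2 f)" by (rule power2_le_imp_le) simp
qed

lemma square_integrable_uminus: "square_integrable f \<Longrightarrow> square_integrable (\<lambda>z. - f z)"
  using square_integrable_scale[of f "-1"] by simp

lemma square_integrable_diff: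
  "square_integrable f \<Longrightarrow> square_integrable g \<Longrightarrow> square_integrable (\<lambda>z. f z - g z)"
  using square_integrable_add[OF _ square_integrable_uminus, of f g] by simp

lemma abs_L2_diff:
  assumes "square_integrable f" "square_integrable g"
  shows "abs_L2 f - abs_L2 g = abs_L2 (\<lambda>z. f z - g z)"
  using assms square_integrable_uminus[OF assms(2)]
  by (simp add: minus_L2_def uminus_L2_def scaleC.abs_eq plus_L2.abs_eq L2_rel_def)

text \<open>A sequence with summable increments in \<open>L\<^sup>2\<close> has summable increments almost
  everywhere, hence a pointwise limit, which Fatou's lemma identifies as the \<open>L\<^sup>2\<close> limit.\<close>

lemma L2_convergent_of_summable_norm:
  fixes X :: "nat \<Rightarrow> L2"
  assumes C: "Cauchy X" and summ: "summable (\<lambda>n. norm (X (Suc n) - X n))"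
  shows "convergent X"
proof -
  have "\<exists>F. \<forall>n. square_integrable (F n) \<and> X n = abs_L2 (F n)"
    by (rule choice) (metis L2_abs_cases)
  then obtain F where F: "\<And>n. square_integrable (F n)" "\<And>n. X n = abs_L2 (F n)" by blast
  have [measurable]: "F n \<in> borel_measurable borel" for n
    using F(1)[of n] by (simp add: square_integrable_def)
  have normF: "(norm (X m - X n))\<^sup>2 = (LINT z|circle_measure. (cmod (F m z - F n z))\<^sup>2)" for m n
    using norm_L2_abs[OF square_integrable_diff[OF F(1) F(1)]] by (simp add: F abs_L2_diff)
  have le: "(LINT z|circle_measure. cmod (F (Suc n) z - F n z)) \<le> norm (X (Suc n) - X n)" for n
    using integral_cmod_le_norm_L2(2)[OF square_integrable_diff[OF F(1) F(1)]]
    by (simp add: F abs_L2_diff)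
  have int: "integrable circle_measure (\<lambda>z. F (Suc n) z - F n z)" for n
    by (rule integral_cmod_le_norm_L2(1)[OF square_integrable_diff[OF F(1) F(1)]])
  have "(\<integral>\<^sup>+z. (\<Sum>n. ennreal (cmod (F (Suc n) z - F n z))) \<partial>circle_measure) =
      (\<Sum>n. \<integral>\<^sup>+z. ennreal (cmod (F (Suc n) z - F n z)) \<partial>circle_measure)"
    by (rule nn_integral_suminf) simp
  also have "\<dots> = (\<Sum>n. ennreal (LINT z|circle_measure. cmod (F (Suc n) z - F n z)))"
    using int by (simp add: nn_integral_eq_integral)
  also have "\<dots> \<le> (\<Sum>n. ennreal (norm (X (Suc n) - X n)))"
    by (intro suminf_le ennreal_leI le) auto
  also have "\<dots> = ennreal (\<Sum>n. norm (X (Suc n) - X n))"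
    by (rule suminf_ennreal_eq) (use summ in auto)
  also have "\<dots> < \<infinity>" by simp
  finally have "AE z in circle_measure. (\<Sum>n. ennreal (cmod (F (Suc n) z - F n z))) \<noteq> \<infinity>"
    by (intro nn_integral_noteq_infinite) auto
  then have conv: "AE z in circle_measure. (\<lambda>n. F n z) \<longlonglongrightarrow> lim (\<lambda>n. F n z)"
  proof eventually_elim
    case (elim z)
    then have "summable (\<lambda>n. cmod (F (Suc n) z - F n z))"
      by (intro summable_suminf_not_top) (auto simp: top_ennreal_def)
    then have "summable (\<lambda>n. F (Suc n) z - F n z)" by (rule summable_norm_cancel)
    then have "convergent (\<lambda>n. F n z)"
      using sum_lessThan_telescope[of "\<lambda>n. F n z"]
      by (simp add: summable_iff_convergent convergent_diff_const_right_iff)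
    then show ?case by (simp add: convergent_LIMSEQ_iff)
  qed
  \<comment> \<open>Where the sequence diverges \<open>lim\<close> has no useful value, but this
    happens only on a null set.\<close>
  define f where "f z = lim (\<lambda>n. F n z)" for z
  have [measurable]: "f \<in> borel_measurable borel" unfolding f_def by measurable
  \<comment> \<open>Square-integrability of the limit is not known in advance. Fatou yields it for
    the difference from \<open>F n\<close> together with the norm estimate.\<close>
  have bound: "square_integrable (\<lambda>z. f z - F n z) \<and> norm (abs_L2 (\<lambda>z. f z - F n z)) \<le> e"
    if "e > 0" and N: "\<And>m. m \<ge> n \<Longrightarrow> norm (X m - X n) \<le> e" for n e
  proof -
    have "(\<integral>\<^sup>+z. ennreal ((cmod (f z - F n z))\<^sup>2) \<partial>circle_measure) =
        (\<integral>\<^sup>+z. liminf (\<lambda>m. ennreal ((cmod (F m z - F n z))\<^sup>2)) \<partial>circle_measure)"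
    proof (rule nn_integral_cong_AE)
      show "AE z in circle_measure. ennreal ((cmod (f z - F n z))\<^sup>2) =
          liminf (\<lambda>m. ennreal ((cmod (F m z - F n z))\<^sup>2))"
        using conv
      proof eventually_elim
        case (elim z)
        then have "(\<lambda>m. ennreal ((cmod (F m z - F n z))\<^sup>2)) \<longlonglongrightarrow> ennreal ((cmod (f z - F n z))\<^sup>2)"
          unfolding f_def by (intro tendsto_ennrealI tendsto_intros)
        then show ?case by (simp only: lim_imp_Liminf[OF sequentially_bot])
      qed
    qed
    also have "\<dots> \<le> liminf (\<lambda>m. \<integral>\<^sup>+z. ennreal ((cmod (F m z - F n z))\<^sup>2) \<partial>circle_measure)"
      by (rule nn_integral_liminf) simp
    also have "\<dots> = liminf (\<lambda>m. ennreal ((norm (X m - X n))\<^sup>2))"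
      using square_integrable_diff[OF F(1) F(1)] 
      by (simp add: normF nn_integral_eq_integral square_integrable_def)
    also have "\<dots> \<le> liminf (\<lambda>m. ennreal (e\<^sup>2))"
      using N by (intro Liminf_mono) (auto simp: eventually_sequentially intro!: exI[of _ n] ennreal_leI power_mono)
    also have "\<dots> = ennreal (e\<^sup>2)" by (simp add: Liminf_const)
    finally have nn: "(\<integral>\<^sup>+z. ennreal ((cmod (f z - F n z))\<^sup>2) \<partial>circle_measure) \<le> ennreal (e\<^sup>2)" .
    then have sq: "square_integrable (\<lambda>z. f z - F n z)"
      unfolding square_integrable_def
      by (auto intro!: integrableI_nonneg order.strict_trans1[OF nn])
    then have "(norm (abs_L2 (\<lambda>z. f z - F n z)))\<^sup>2 \<le> e\<^sup>2"
      using nn that(1) by (simp add: norm_L2_abs nn_integral_eq_integral square_integrable_def)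
    then have "norm (abs_L2 (\<lambda>z. f z - F n z)) \<le> e"
      by (rule power2_le_imp_le) (use that in simp)
    with sq show ?thesis by simp
  qed
  have near: "\<exists>N. \<forall>n\<ge>N. \<forall>m\<ge>n. norm (X m - X n) \<le> e" if "e > 0" for e
    using C that unfolding Cauchy_iff by (meson less_imp_le order_trans)
  \<comment> \<open>A single tolerance, here 1, is enough to conclude that \<open>f\<close>, the sum
    of \<open>f - F N\<close> and \<open>F N\<close>, is square-integrable.\<close>
  obtain N where "\<forall>n\<ge>N. \<forall>m\<ge>n. norm (X m - X n) \<le> 1" using near[of 1] by auto
  then have "square_integrable (\<lambda>z. f z - F N z)" using bound[of 1 N] by simp
  from square_integrable_add[OF this F(1)[of N]] have sf: "square_integrable f" by simp
  have "X \<longlonglongrightarrow> abs_L2 f"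
  proof (rule LIMSEQ_I)
    fix e :: real assume "e > 0"
    then obtain M where M: "\<forall>n\<ge>M. \<forall>m\<ge>n. norm (X m - X n) \<le> e / 2" using near[of "e / 2"] by auto
    have "norm (X n - abs_L2 f) < e" if "n \<ge> M" for n
    proof -
      have "norm (abs_L2 f - X n) \<le> e / 2"
        using bound[of "e / 2" n] M that \<open>e > 0\<close> by (simp add: F abs_L2_diff sf)
      then show ?thesis using \<open>e > 0\<close> by (simp add: norm_minus_commute)
    qed
    then show "\<exists>M. \<forall>n\<ge>M. norm (X n - abs_L2 f) < e" by blast
  qed
  then show ?thesis by (rule convergentI)
qed

text \<open>A subsequence with increments below 2^(-k) has summable increments and so converges; a
  Cauchy sequence shares the limit of any of its subsequences.\<close>

instance L2 :: banach
proof
  fix X :: "nat \<Rightarrow> L2"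
  assume C: "Cauchy X"
  have "\<exists>N. \<forall>m\<ge>N. \<forall>n\<ge>N. norm (X m - X n) < (1/2)^k" for k
    using C unfolding Cauchy_iff by simp
  then obtain N where N: "\<And>k m n. m \<ge> N k \<Longrightarrow> n \<ge> N k \<Longrightarrow> norm (X m - X n) < (1/2)^k"
    by metis
  \<comment> \<open>The summand \<open>k\<close> forces strict growth, and the sum dominates
    \<open>N k\<close>.\<close>
  define r where "r k = k + (\<Sum>j\<le>k. N j)" for k
  have r: "strict_mono r" unfolding r_def by (rule strict_monoI_Suc) simp
  have rN: "N k \<le> r k" for k
    unfolding r_def using member_le_sum[of k "{..k}" N] by simp
  have "norm (norm ((X \<circ> r) (Suc k) - (X \<circ> r) k)) \<le> (1/2)^k" for k
    using N[of k "r (Suc k)" "r k"] rN[of k] strict_mono_less_eq[OF r, of k "Suc k"]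
    by (simp add: less_imp_le)
  then have "summable (\<lambda>k. norm ((X \<circ> r) (Suc k) - (X \<circ> r) k))"
    by (intro summable_comparison_test'[OF summable_geometric[of "1/2 :: real"], where N = 0]) auto
  moreover have "Cauchy (X \<circ> r)" by (rule Cauchy_subseq_Cauchy[OF C r])
  ultimately obtain L where "(X \<circ> r) \<longlonglongrightarrow> L"
    using L2_convergent_of_summable_norm[of "X \<circ> r"] by (auto simp: convergent_def)
  then show "convergent X"
    using Cauchy_converges_subseq[OF C r] by (auto simp: convergent_def)
qed

section \<open>Completeness of the trigonometric system\<close>

text \<open>The index runs through all integers, so on the circle conjugating the powers would give
  the same condition. Working with functions instead of elements of \<open>L2\<close> lets
  continuous functions and indicators enter as plain factors.\<close>

definition zero_fourier :: "(complex \<Rightarrow> complex) \<Rightarrow> bool" where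
  "zero_fourier f \<longleftrightarrow> integrable circle_measure f \<and> (\<forall>n. (LINT z|circle_measure. f z * z powi n) = 0)"

lemma powi_borel_measurable [measurable]: "(\<lambda>z::complex. z powi n) \<in> borel_measurable borel"
  using square_integrable_powi[of n] by (simp add: square_integrable_def)

lemma integrable_mult_bounded_on_circle:
  fixes f g :: "complex \<Rightarrow> complex"
  assumes "integrable circle_measure f" "g \<in> borel_measurable borel"
    and "\<And>z. cmod z = 1 \<Longrightarrow> cmod (g z) \<le> C"
  shows "integrable circle_measure (\<lambda>z. f z * g z)"
proof (rule Bochner_Integration.integrable_bound)
  show "integrable circle_measure (\<lambda>z. C * cmod (f z))" using assms(1) by simp
  show "AE z in circle_measure. norm (f z * g z) \<le> norm (C * cmod (f z))"
    using AE_circle_measure_norm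
  proof eventually_elim
    case (elim z)
    then have "cmod (f z) * cmod (g z) \<le> cmod (f z) * \<bar>C\<bar>"
      using assms(3)[of z] by (intro mult_left_mono) auto
    then show ?case by (simp add: norm_mult abs_mult mult.commute)
  qed
  have [measurable]: "f \<in> borel_measurable borel" using assms(1) by auto
  note assms(2) [measurable]
  show "(\<lambda>z. f z * g z) \<in> borel_measurable circle_measure" by simp
qed

lemma integrable_mult_powi:
  "integrable circle_measure f \<Longrightarrow> integrable circle_measure (\<lambda>z. f z * z powi n)"
  by (rule integrable_mult_bounded_on_circle[where C = 1]) (simp_all add: norm_power_int)

lemma integrable_mult_continuous_on_circle:
  fixes g :: "complex \<Rightarrow> real"
  assumes "integrable circle_measure f" "continuous_on UNIV g"
  shows "integrable circle_measure (\<lambda>z. f z * complex_of_real (g z))"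
proof -
  have "compact (g ` sphere 0 1)"
    using assms(2) by (intro compact_continuous_image) (auto intro: continuous_on_subset)
  then obtain C where C: "\<forall>x \<in> g ` sphere 0 1. norm x \<le> C"
    using compact_imp_bounded bounded_iff by metis
  have [measurable]: "g \<in> borel_measurable borel"
    using assms(2) by (rule borel_measurable_continuous_onI)
  show ?thesis
  proof (rule integrable_mult_bounded_on_circle[OF assms(1)])
    show "cmod (complex_of_real (g z)) \<le> C" if "cmod z = 1" for z
      using C that by simp
  qed simp
qed

text \<open>On the circle a real-linear function is u z + v / z, so multiplying by it only mixes
  Fourier coefficients at neighbouring indices.\<close>

lemma zero_fourier_mult_linear:
  assumes p: "bounded_linear p" and f: "zero_fourier f"
  shows "zero_fourier (\<lambda>z. f z * complex_of_real (p z))"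
proof -
  have fi: "integrable circle_measure f" using f by (simp add: zero_fourier_def)
  interpret bounded_linear p by (rule p)
  have [measurable]: "f \<in> borel_measurable borel" using fi by auto
  have cont: "continuous_on UNIV p" by (intro linear_continuous_on p)
  then have [measurable]: "p \<in> borel_measurable borel" by (rule borel_measurable_continuous_onI)
  have int: "integrable circle_measure (\<lambda>z. f z * complex_of_real (p z))"
    by (rule integrable_mult_continuous_on_circle[OF fi cont])
  \<comment> \<open>Obtained from p(z) = Re z p(1) + Im z p(i) by expressing Re z and Im z through z
    and its conjugate.\<close>
  define u where "u = (complex_of_real (p 1) - \<i> * p \<i>) / 2"
  define v where "v = (complex_of_real (p 1) + \<i> * p \<i>) / 2"
  have "(LINT z|circle_measure. f z * complex_of_real (p z) * z powi n) = 0" for n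
  proof -
    have "(LINT z|circle_measure. f z * complex_of_real (p z) * z powi n) =
        (LINT z|circle_measure. u * (f z * z powi (n + 1)) + v * (f z * z powi (n - 1)))"
    proof (rule integral_cong_AE)
      show "AE z in circle_measure. f z * complex_of_real (p z) * z powi n =
          u * (f z * z powi (n + 1)) + v * (f z * z powi (n - 1))"
        using AE_circle_measure_norm
      proof eventually_elim
        case (elim z)
        then have z0: "z \<noteq> 0" by auto
        have "z * cnj z = 1" using elim complex_norm_square[of z] by simp
        then have inv: "inverse z = cnj z" by (metis inverse_unique)
        have "p z = p (Re z *\<^sub>R 1 + Im z *\<^sub>R \<i>)"
          by (rule arg_cong[where f = p]) (simp add: complex_eq_iff)
        also have "\<dots> = Re z * p 1 + Im z * p \<i>" by (simp only: add scale) simp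
        finally have pz: "p z = Re z * p 1 + Im z * p \<i>" .
        have "u * z + v * cnj z = p 1 * ((z + cnj z) / 2) - \<i> * p \<i> * ((z - cnj z) / 2)"
          by (simp add: u_def v_def algebra_simps add_divide_distrib diff_divide_distrib)
        also have "\<dots> = complex_of_real (p z)"
          by (simp add: complex_add_cnj complex_diff_cnj pz complex_eq_iff)
        finally have uv: "complex_of_real (p z) = u * z + v * cnj z" ..
        have e1: "z powi (n + 1) = z powi n * z" using z0 by (simp add: power_int_add)
        have e2: "z powi (n - 1) = z powi n * cnj z"
          using z0 by (simp add: power_int_diff divide_inverse inv)
        show ?case unfolding uv e1 e2 by (simp add: algebra_simps)
      qed
    qed auto
    also have "\<dots> = 0"
      using f integrable_mult_powi[OF fi] by (simp add: zero_fourier_def)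
    finally show ?thesis .
  qed
  with int show ?thesis by (simp add: zero_fourier_def)
qed

text \<open>\<open>f\<close> is generalized because the product case first multiplies by
  \<open>p\<close> and then applies the hypothesis for \<open>q\<close> to the resulting
  function.\<close>

lemma zero_fourier_mult_polynomial:
  assumes "real_polynomial_function p" "zero_fourier f"
  shows "zero_fourier (\<lambda>z. f z * complex_of_real (p z))"
  using assms
proof (induction p arbitrary: f rule: real_polynomial_function.induct)
  case (linear p)
  then show ?case by (rule zero_fourier_mult_linear)
next
  case (const c)
  have *: "f z * complex_of_real c * z powi n = complex_of_real c * (f z * z powi n)" for z n
    by (simp only: mult_ac)
  show ?case using const by (simp add: zero_fourier_def *)
next
  case (add p q)
  then show ?case
    using add.IH(1)[OF add.prems] add.IH(2)[OF add.prems]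
    by (simp add: zero_fourier_def distrib_left distrib_right integrable_mult_powi)
next
  case (mult p q)
  then show ?case
    using mult.IH(2)[OF mult.IH(1)[OF mult.prems]] by (simp add: mult.assoc)
qed

text \<open>By Stone-Weierstrass a polynomial in the real coordinates is uniformly within
  \<open>e\<close> of \<open>g\<close> on the circle. Its integral against \<open>f\<close>
  vanishes, so the error is at most \<open>e\<close> times the L^1 norm of \<open>f\<close>.\<close>

lemma zero_fourier_integral_continuous:
  fixes g :: "complex \<Rightarrow> real"
  assumes f: "zero_fourier f" and g: "continuous_on UNIV g"
  shows "(LINT z|circle_measure. f z * complex_of_real (g z)) = 0"
proof -
  have fi: "integrable circle_measure f" using f by (simp add: zero_fourier_def)
  define K where "K = (LINT z|circle_measure. cmod (f z))"
  have K: "0 \<le> K" by (simp add: K_def)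
  have *: "cmod (LINT z|circle_measure. f z * complex_of_real (g z)) \<le> e * K" if e: "e > 0" for e
  proof -
    have "continuous_on (sphere 0 1) g" using g by (rule continuous_on_subset) simp
    then obtain p where p: "real_polynomial_function p"
      and app: "\<And>z. z \<in> sphere 0 1 \<Longrightarrow> \<bar>g z - p z\<bar> < e"
      using Stone_Weierstrass_real_polynomial_function[OF compact_sphere _ e] by blast
    have cp: "continuous_on UNIV p"
      using p by (simp add: real_polynomial_function_eq continuous_on_polymonial_function)
    have "(LINT z|circle_measure. f z * complex_of_real (p z)) = 0"
      using zero_fourier_mult_polynomial[OF p f] 
      by (auto simp: zero_fourier_def dest: spec[of _ 0])
    then have "(LINT z|circle_measure. f z * complex_of_real (g z)) =
        (LINT z|circle_measure. f z * complex_of_real (g z) - f z * complex_of_real (p z))"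
      using integrable_mult_continuous_on_circle[OF fi g]
        integrable_mult_continuous_on_circle[OF fi cp] by simp
    also have "cmod \<dots> \<le>
        (LINT z|circle_measure. cmod (f z * complex_of_real (g z) - f z * complex_of_real (p z)))"
      by (rule integral_norm_bound)
    also have "\<dots> \<le> (LINT z|circle_measure. e * cmod (f z))"
    proof (rule integral_mono_AE)
      show "AE z in circle_measure.
          cmod (f z * complex_of_real (g z) - f z * complex_of_real (p z)) \<le> e * cmod (f z)"
        using AE_circle_measure_norm
      proof eventually_elim
        case (elim z)
        have "cmod (f z * complex_of_real (g z) - f z * complex_of_real (p z)) =
            cmod (f z) * \<bar>g z - p z\<bar>"
          by (simp add: norm_mult flip: right_diff_distrib of_real_diff)
        also have "\<dots> \<le> cmod (f z) * e"
          using app[of z] elim by (intro mult_left_mono) auto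
        finally show ?case by (simp add: mult.commute)
      qed
    qed (use integrable_mult_continuous_on_circle[OF fi g]
        integrable_mult_continuous_on_circle[OF fi cp] fi in auto)
    also have "\<dots> = e * K" by (simp add: K_def)
    finally show ?thesis .
  qed
  have "cmod (LINT z|circle_measure. f z * complex_of_real (g z)) \<le> 0 + e" if "e > 0" for e
  proof -
    \<comment> \<open>The denominator is K + 1 because K itself may be 0.\<close>
    have "e / (K + 1) * K \<le> e" using that K by (simp add: field_simps)
    then show ?thesis using *[of "e / (K + 1)"] that K by simp
  qed
  then have "cmod (LINT z|circle_measure. f z * complex_of_real (g z)) \<le> 0"
    by (rule field_le_epsilon)
  then show ?thesis by simp
qed

text \<open>Off a nonempty closed set the distance is positive, so the term drops to 0 for large n.
  For the empty set \<open>infdist\<close> is 0 by convention and the terms would be constantly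
  1.\<close>

lemma tendsto_indicator_closed:
  fixes F :: "'a :: metric_space set"
  assumes "closed F" "F \<noteq> {}"
  shows "(\<lambda>n. max 0 (1 - real n * infdist z F)) \<longlonglongrightarrow> indicator F z"
proof (cases "z \<in> F")
  case True
  then show ?thesis by simp
next
  case False
  then have pos: "infdist z F > 0" using assms by (simp add: infdist_pos_not_in_closed)
  obtain N where N: "1 < real N * infdist z F" using pos reals_Archimedean3 by blast
  have "\<forall>\<^sub>F n in sequentially. max 0 (1 - real n * infdist z F) = indicator F z"
    using eventually_ge_at_top[of N]
  proof eventually_elim
    case (elim n)
    then have "real N * infdist z F \<le> real n * infdist z F" using pos by simp
    then show ?case using N False by simp
  qed
  then show ?thesis by (rule tendsto_eventually)
qed

lemma zero_fourier_set_integral_closed: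
  assumes f: "zero_fourier f" and F: "closed F"
  shows "(LINT z:F|circle_measure. f z) = 0"
proof (cases "F = {}")
  case False
  have fi: "integrable circle_measure f" using f by (simp add: zero_fourier_def)
  have [measurable]: "f \<in> borel_measurable borel" using fi by auto
  have [measurable]: "F \<in> sets borel" using F by simp
  define g where "g n z = max 0 (1 - real n * infdist z F)" for n z
  have g: "continuous_on UNIV (g n)" for n
    unfolding g_def by (intro continuous_intros)
  have [measurable]: "g n \<in> borel_measurable borel" for n
    using g by (rule borel_measurable_continuous_onI)
  have "(\<lambda>n. LINT z|circle_measure. f z * complex_of_real (g n z)) \<longlonglongrightarrow>
      (LINT z|circle_measure. f z * complex_of_real (indicator F z))"
  proof (rule integral_dominated_convergence)
    show "AE z in circle_measure. (\<lambda>n. f z * complex_of_real (g n z)) \<longlonglongrightarrow>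
        f z * complex_of_real (indicator F z)"
      unfolding g_def by (intro AE_I2 tendsto_intros tendsto_indicator_closed F False)
    show "AE z in circle_measure. norm (f z * complex_of_real (g n z)) \<le> cmod (f z)" for n
    proof (rule AE_I2)
      fix z
      have "\<bar>g n z\<bar> \<le> 1" unfolding g_def by (simp add: infdist_nonneg)
      then show "norm (f z * complex_of_real (g n z)) \<le> cmod (f z)"
        by (simp add: norm_mult mult_left_le)
    qed
  qed (use fi in auto)
  moreover have "(LINT z|circle_measure. f z * complex_of_real (g n z)) = 0" for n
    by (rule zero_fourier_integral_continuous[OF f g])
  ultimately have "(LINT z|circle_measure. f z * complex_of_real (indicator F z)) = 0"
    by (simp add: LIMSEQ_const_iff)
  then show ?thesis
    by (simp add: set_lebesgue_integral_def scaleR_conv_of_real mult.commute)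
qed (simp add: set_lebesgue_integral_def)

text \<open>The closed sets are stable under intersection and generate the Borel sets, so vanishing
  of the integrals extends from closed to Borel sets; an integrable function is determined almost
  everywhere by its integrals.\<close>

lemma zero_fourier_AE_zero:
  assumes f: "zero_fourier f"
  shows "AE z in circle_measure. f z = 0"
proof (rule sigma_finite_measure.density_unique_banach)
  have fi: "integrable circle_measure f" using f by (simp add: zero_fourier_def)
  show "integrable circle_measure f" "integrable circle_measure (\<lambda>z. 0 :: complex)" using fi by auto
  show "sigma_finite_measure circle_measure"
    by (rule prob_space_imp_sigma_finite[OF prob_space_circle_measure])
  have si: "set_integrable circle_measure A f" if "A \<in> sets borel" for A
    unfolding set_integrable_def using fi that by (intro integrable_mult_indicator) auto
  \<comment> \<open>The whole plane is closed; its vanishing integral settles the complement case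
    below.\<close>
  have "(LINT z:UNIV|circle_measure. f z) = 0"
    by (rule zero_fourier_set_integral_closed[OF f]) simp
  then have full: "(LINT z|circle_measure. f z) = 0" by (simp add: set_lebesgue_integral_def)
  fix A assume "A \<in> sets circle_measure"
  then have "Int_stable (Collect closed :: complex set set)" "Collect closed \<subseteq> Pow (UNIV :: complex set)"
      "A \<in> sigma_sets UNIV (Collect closed)"
    by (auto simp: borel_eq_closed Int_stable_def)
  then have "(LINT z:A|circle_measure. f z) = 0"
  proof (induction rule: sigma_sets_induct_disjoint)
    case (basic A)
    then show ?case using zero_fourier_set_integral_closed[OF f] by simp
  next
    case (compl A)
    then have "A \<in> sets borel" by (simp add: borel_eq_closed)
    from si[OF this] have i: "integrable circle_measure (\<lambda>z. indicator A z *\<^sub>R f z)"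
      by (simp add: set_integrable_def)
    have "(LINT z:UNIV - A|circle_measure. f z) =
        (LINT z|circle_measure. f z - indicator A z *\<^sub>R f z)"
      unfolding set_lebesgue_integral_def
      by (rule Bochner_Integration.integral_cong) (auto simp: indicator_def)
    also have "\<dots> = 0" using fi i full compl by (simp add: set_lebesgue_integral_def)
    finally show ?case .
  next
    case (union A)
    then have A: "A i \<in> sets borel" for i by (auto simp: borel_eq_closed)
    then have "(LINT z:(\<Union>i. A i)|circle_measure. f z) = (\<Sum>i. LINT z:A i|circle_measure. f z)"
      using union by (intro lebesgue_integral_countable_add si) (auto simp: disjoint_family_on_def)
    then show ?case using union by simp
  qed (simp add: set_lebesgue_integral_def)
  then show "(LINT z:A|circle_measure. f z) = (LINT z:A|circle_measure. 0)"
    by (simp add: set_lebesgue_integral_def)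
qed

lemma eq_zero_of_cinner_zpow:
  assumes "\<And>n. cinner x (zpow n) = 0"
  shows "x = 0"
proof -
  obtain f where f: "square_integrable f" "x = abs_L2 f" by (rule L2_abs_cases)
  have "(LINT z|circle_measure. f z * z powi n) = 0" for n
  proof -
    have "cinner x (conj_L2 (zpow n)) = 0" using assms by (simp add: conj_zpow)
    moreover have "conj_L2 (zpow n) = abs_L2 (\<lambda>z. cnj (z powi n))"
      using square_integrable_powi[of n] by (simp add: zpow_def conj_L2.abs_eq L2_rel_def)
    moreover have "cinner (abs_L2 f) (abs_L2 (\<lambda>z. cnj (z powi n))) =
        (LINT z|circle_measure. f z * cnj (cnj (z powi n)))"
      using f(1) square_integrable_cnj[OF square_integrable_powi[of n]]
      by (intro cinner.abs_eq) (simp_all add: L2_rel_def)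
    ultimately show ?thesis using f by simp
  qed
  then have "zero_fourier f"
    using integral_cmod_le_norm_L2(1)[OF f(1)] by (simp add: zero_fourier_def)
  then have "AE z in circle_measure. f z = 0" by (rule zero_fourier_AE_zero)
  then have "abs_L2 f = abs_L2 (\<lambda>_. 0)"
    using f(1) square_integrable_zero
    by (intro Quotient_rel_abs[OF Quotient_L2]) (simp add: L2_rel_def)
  then show ?thesis using f by (simp add: zero_L2_def)
qed

section \<open>The Riesz projection and model spaces\<close>

lemma bounded_linear_cinner_left: "bounded_linear (\<lambda>x. cinner x y)"
proof (rule bounded_linear_intro)
  show "cinner (a + b) y = cinner a y + cinner b y" for a b by (rule cinner_add_left)
  show "cinner (r *\<^sub>R a) y = r *\<^sub>R cinner a y" for r a
    by (simp add: scaleR_L2_def scaleR_conv_of_real)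
  show "norm (cinner a y) \<le> norm a * norm y" for a by (rule norm_cinner_le)
qed

section \<open>Bessel's inequality and the negative part of the Fourier series\<close>

lemma cinner_sum_left: "cinner (\<Sum>k\<in>A. f k) y = (\<Sum>k\<in>A. cinner (f k) y)"
  by (rule linear_sum[OF bounded_linear.linear[OF bounded_linear_cinner_left]])

lemma cinner_sum_right: "cinner y (\<Sum>k\<in>A. f k) = (\<Sum>k\<in>A. cinner y (f k))"
proof -
  have "cinner y (\<Sum>k\<in>A. f k) = cnj (\<Sum>k\<in>A. cinner (f k) y)"
    by (simp only: cinner_commute[of y "sum f A"] cinner_sum_left)
  also have "\<dots> = (\<Sum>k\<in>A. cinner y (f k))"
    by (simp only: cnj_sum cinner_commute[symmetric])
  finally show ?thesis .
qed

text \<open>Numbers the negative modes by naturals; \<open>Suc k\<close> keeps the constant mode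
  out, since that one belongs to \<open>H2\<close>.\<close>

definition neg_term :: "L2 \<Rightarrow> nat \<Rightarrow> L2" where
  "neg_term x k = cinner x (zpow (- int (Suc k))) *\<^sub>C zpow (- int (Suc k))"

lemma cinner_sum_neg_term:
  "cinner x (\<Sum>k\<in>A. neg_term x k) =
    complex_of_real (\<Sum>k\<in>A. (cmod (cinner x (zpow (- int (Suc k)))))\<^sup>2)"
  by (simp add: cinner_sum_right neg_term_def complex_norm_square mult.commute del: of_nat_Suc of_real_power)

text \<open>By orthonormality the partial sum s and x have the same coefficients on
  \<open>A\<close>, hence <s, s> = <x, s>.\<close>

lemma norm_sum_neg_term:
  assumes "finite A"
  shows "(norm (\<Sum>k\<in>A. neg_term x k))\<^sup>2 = (\<Sum>k\<in>A. (cmod (cinner x (zpow (- int (Suc k)))))\<^sup>2)"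
proof -
  let ?s = "\<Sum>k\<in>A. neg_term x k"
  have "cinner ?s (neg_term x k) = cinner x (neg_term x k)" if "k \<in> A" for k
  proof -
    have "cinner (neg_term x j) (neg_term x k) = (if j = k then cinner x (neg_term x k) else 0)" for j
      by (simp add: neg_term_def cinner_zpow del: of_nat_Suc)
    then show ?thesis using assms that by (simp add: cinner_sum_left)
  qed
  then have "cinner ?s ?s = cinner x ?s" by (simp add: cinner_sum_right)
  then show ?thesis unfolding cinner_sum_neg_term cinner_self by (simp only: of_real_eq_iff)
qed

text \<open>Bessel's inequality: the partial sum s satisfies |s|^2 = <x, s>, and Cauchy-Schwarz then
  gives |s| at most |x|.\<close>

lemma sum_coeff_le:
  assumes "finite A"
  shows "(\<Sum>k\<in>A. (cmod (cinner x (zpow (- int (Suc k)))))\<^sup>2) \<le> (norm x)\<^sup>2"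
proof -
  let ?s = "\<Sum>k\<in>A. neg_term x k"
  have "cmod (cinner x ?s) = (norm ?s)\<^sup>2"
    unfolding cinner_sum_neg_term norm_sum_neg_term[OF assms]
    by (simp only: norm_of_real abs_of_nonneg sum_nonneg zero_le_power2)
  then have "norm ?s * norm ?s \<le> norm x * norm ?s"
    using norm_cinner_le[of x ?s] by (simp add: power2_eq_square)
  then have "norm ?s \<le> norm x" by (cases "norm ?s = 0") (simp_all add: mult_le_cancel_right)
  then show ?thesis unfolding norm_sum_neg_term[OF assms, symmetric] by (intro power_mono) simp_all
qed

text \<open>The squared norm of a block of terms is the same block of the convergent series of
  squared coefficients, so the partial sums are Cauchy. Completeness of \<open>L2\<close> is used
  here.\<close>

lemma summable_neg_term: "summable (neg_term x)"
proof -
  define a where "a k = (cmod (cinner x (zpow (- int (Suc k)))))\<^sup>2" for k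
  have a: "summable a"
    by (rule summableI_nonneg_bounded[where x = "(norm x)\<^sup>2"])
      (use sum_coeff_le[of "{..<_}" x] in \<open>simp_all add: a_def\<close>)
  show ?thesis unfolding summable_Cauchy
  proof (intro allI impI)
    fix e :: real assume e: "e > 0"
    then obtain N where N: "\<And>m n. m \<ge> N \<Longrightarrow> norm (sum a {m..<n}) < e\<^sup>2"
      using a unfolding summable_Cauchy by (meson zero_less_power)
    have "norm (sum (neg_term x) {m..<n}) < e" if "m \<ge> N" for m n
    proof -
      have "(norm (sum (neg_term x) {m..<n}))\<^sup>2 < e\<^sup>2"
        using N[OF that, of n] by (simp add: norm_sum_neg_term a_def)
      then show ?thesis using e by (simp add: power2_less_imp_less)
    qed
    then show "\<exists>N. \<forall>m\<ge>N. \<forall>n. norm (sum (neg_term x) {m..<n}) < e" by blast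
  qed
qed

lemma cinner_suminf_neg_term:
  "cinner (\<Sum>n. neg_term x (n + m)) y = (\<Sum>n. cinner (neg_term x (n + m)) y)"
  using bounded_linear.suminf[OF bounded_linear_cinner_left summable_ignore_initial_segment[OF summable_neg_term]]
  by simp

text \<open>Only the term with n = j - m survives. The case m = 0 serves the construction of P, and
  general tails serve the approximation by z^(-n) H^2.\<close>

lemma cinner_tail_neg_term:
  assumes "m \<le> j"
  shows "cinner (\<Sum>n. neg_term x (n + m)) (zpow (- int (Suc j))) = cinner x (zpow (- int (Suc j)))"
proof -
  have "(\<Sum>n. cinner (neg_term x (n + m)) (zpow (- int (Suc j)))) =
      (\<Sum>n\<in>{j - m}. cinner (neg_term x (n + m)) (zpow (- int (Suc j))))"
    by (rule suminf_finite) (use assms in \<open>auto simp: neg_term_def cinner_zpow\<close>)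
  also have "\<dots> = cinner x (zpow (- int (Suc j)))"
    using assms by (simp add: neg_term_def cinner_zpow)
  finally show ?thesis by (simp add: cinner_suminf_neg_term)
qed

lemma H2_diff: "x \<in> H2 \<Longrightarrow> y \<in> H2 \<Longrightarrow> x - y \<in> H2"
  by (simp add: H2_def cinner_diff_left)

lemma H2_add: "x \<in> H2 \<Longrightarrow> y \<in> H2 \<Longrightarrow> x + y \<in> H2"
  by (simp add: H2_def cinner_add_left)

lemma H2_scaleC: "x \<in> H2 \<Longrightarrow> c *\<^sub>C x \<in> H2"
  by (simp add: H2_def)

lemma H2_zpow: "0 \<le> n \<Longrightarrow> zpow n \<in> H2"
  by (auto simp: H2_def cinner_zpow)

lemma cinner_zpow_mult_left: "cinner (zpow k \<odot> x) y = cinner x (zpow (- k) \<odot> y)"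
  by (simp add: cinner_mult_left Linf_zpow conj_zpow)

lemma zpow_mult_zpow_mult [simp]: "zpow m \<odot> (zpow n \<odot> x) = zpow (m + n) \<odot> x"
  by (simp add: Linf_mult_assoc Linf_zpow zpow_add)

lemma H2_zpow_mult: "0 \<le> k \<Longrightarrow> x \<in> H2 \<Longrightarrow> zpow k \<odot> x \<in> H2"
  by (auto simp: H2_def cinner_zpow_mult_left zpow_add)

text \<open>Two candidates differ by an element of \<open>V\<close> that is orthogonal to itself.
  Existence is discharged by the supplied \<open>y\<close>.\<close>

lemma orth_proj_eqI:
  assumes V: "\<And>x y. x \<in> V \<Longrightarrow> y \<in> V \<Longrightarrow> x - y \<in> V"
    and y: "y \<in> V" "\<And>v. v \<in> V \<Longrightarrow> cinner (x - y) v = 0"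
  shows "orth_proj V x = y"
  unfolding orth_proj_def
proof (rule the_equality)
  show "y \<in> V \<and> (\<forall>v\<in>V. cinner (x - y) v = 0)" using y by blast
  fix y' assume y': "y' \<in> V \<and> (\<forall>v\<in>V. cinner (x - y') v = 0)"
  then have "cinner (y - y') (y - y') = cinner (x - y') (y - y') - cinner (x - y) (y - y')"
    by (simp add: cinner_diff_left)
  also have "\<dots> = 0" using V y y' by simp
  finally show "y' = y" by (simp add: cinner_self)
qed

lemma adjoint_op_eqI:
  assumes V: "\<And>x y. x \<in> V \<Longrightarrow> y \<in> V \<Longrightarrow> x - y \<in> V"
    and x: "x \<in> V" "\<And>v. v \<in> V \<Longrightarrow> cinner (A v) y = cinner v x"
  shows "adjoint_op V W A y = x"
  unfolding adjoint_op_def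
proof (rule the_equality)
  show "x \<in> V \<and> (\<forall>v\<in>V. cinner (A v) y = cinner v x)" using x by blast
  fix x' assume x': "x' \<in> V \<and> (\<forall>v\<in>V. cinner (A v) y = cinner v x')"
  then have "cinner (x' - x) (x' - x) = 0"
    using V x by (simp add: cinner_diff_right)
  then show "x' = x" by (simp add: cinner_self)
qed

section \<open>The Riesz projection P\<close>

abbreviation riesz :: "L2 \<Rightarrow> L2" where
  "riesz \<equiv> orth_proj H2"

lemma negative_int_cases:
  fixes n :: int
  assumes "n < 0" obtains k where "n = - int (Suc k)"
  using assms that[of "nat (- n - 1)"] by simp

text \<open>The candidate is x minus its negative Fourier part. Cancelling the negative coefficients
  gives membership in \<open>H2\<close> directly, and the removed series is orthogonal to
  \<open>H2\<close> term by term.\<close>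

lemma riesz_spec: "riesz x \<in> H2 \<and> (\<forall>h\<in>H2. cinner (x - riesz x) h = 0)"
proof -
  let ?N = "\<Sum>n. neg_term x n"
  have N: "x - ?N \<in> H2"
    unfolding H2_def mem_Collect_eq
  proof (intro allI impI)
    fix n :: int assume "n < 0"
    then obtain k where "n = - int (Suc k)" by (rule negative_int_cases)
    then show "cinner (x - ?N) (zpow n) = 0"
      using cinner_tail_neg_term[of 0 k x] by (simp add: cinner_diff_left del: of_nat_Suc)
  qed
  have N0: "cinner ?N h = 0" if "h \<in> H2" for h
  proof -
    have "cinner (neg_term x n) h = 0" for n
      using that cinner_commute[of "zpow (- int (Suc n))" h]
      by (simp add: neg_term_def H2_def)
    then show ?thesis using cinner_suminf_neg_term[of x 0 h] by simp
  qed
  have "riesz x = x - ?N"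
  proof (rule orth_proj_eqI)
    show "x - y \<in> H2" if "x \<in> H2" "y \<in> H2" for x y using that by (rule H2_diff)
  qed (simp_all add: N N0)
  then show ?thesis using N N0 by simp
qed

lemma riesz_in_H2 [simp]: "riesz x \<in> H2" using riesz_spec by blast

lemma cinner_riesz_left: "h \<in> H2 \<Longrightarrow> cinner (riesz x) h = cinner x h"
  using riesz_spec[of x] by (simp add: cinner_diff_left)

lemma cinner_riesz_right: "h \<in> H2 \<Longrightarrow> cinner h (riesz x) = cinner h x"
  by (metis cinner_riesz_left cinner_commute)

lemma riesz_eqI:
  assumes "y \<in> H2" "\<And>h. h \<in> H2 \<Longrightarrow> cinner x h = cinner y h"
  shows "riesz x = y"
  using assms by (intro orth_proj_eqI H2_diff) (simp_all add: cinner_diff_left)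

lemma riesz_diff: "riesz (x - y) = riesz x - riesz y"
  by (rule riesz_eqI) (simp_all add: H2_diff cinner_diff_left cinner_riesz_left)

lemma riesz_add: "riesz (x + y) = riesz x + riesz y"
  by (rule riesz_eqI) (simp_all add: H2_add cinner_add_left cinner_riesz_left)

lemma riesz_scaleC: "riesz (c *\<^sub>C x) = c *\<^sub>C riesz x"
  by (rule riesz_eqI) (simp_all add: H2_scaleC cinner_riesz_left)

lemma riesz_ident: "x \<in> H2 \<Longrightarrow> riesz x = x"
  by (rule riesz_eqI) simp_all

text \<open>The increasing subspaces \<open>z\<^sup>-\<^sup>n H\<^sup>2\<close> exhaust \<open>L\<^sup>2\<close>.\<close>

lemma zpow_mult_near_H2:
  assumes "e > 0"
  obtains n y where "y \<in> H2" "norm (zpow (int n) \<odot> x - y) < e"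
proof -
  obtain N where N: "norm (\<Sum>i. neg_term x (i + N)) < e"
    using suminf_exist_split[OF assms summable_neg_term] by blast
  \<comment> \<open>\<open>x - ?t\<close> retains only the negative modes -1, ..., -N, which z^N
    carries to nonnegative indices.\<close>
  let ?t = "\<Sum>i. neg_term x (i + N)"
  have "zpow (int N) \<odot> (x - ?t) \<in> H2"
    unfolding H2_def mem_Collect_eq
  proof (intro allI impI)
    fix m :: int assume "m < 0"
    \<comment> \<open>Moving z^N to the other side turns the test index m into m - N, which lies in
      the range of the removed tail.\<close>
    then have m: "- int N + m = - int (Suc (N + nat (- m - 1)))" by simp
    have "cinner (x - ?t) (zpow (- int (Suc (N + nat (- m - 1))))) = 0"
      by (simp only: cinner_diff_left cinner_tail_neg_term[of N "N + nat (- m - 1)" x] le_add1) simp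
    then show "cinner (zpow (int N) \<odot> (x - ?t)) (zpow m) = 0"
      by (simp only: cinner_zpow_mult_left zpow_add m)
  qed
  moreover have "zpow (int N) \<odot> x - zpow (int N) \<odot> (x - ?t) = zpow (int N) \<odot> ?t"
    by (simp add: Linf_mult_diff Linf_zpow)
  ultimately show thesis
    using N that[of "zpow (int N) \<odot> (x - ?t)" N]
    by (simp add: norm_unimodular_mult unimodular_zpow)
qed

text \<open>Density of the analytic polynomials in \<open>H2\<close>, in dual form: all Fourier
  coefficients of P g vanish, so P g = 0 by completeness of the trigonometric system.\<close>

lemma cinner_H2_eq_zero:
  assumes f: "f \<in> H2" and g: "\<And>n. 0 \<le> n \<Longrightarrow> cinner g (zpow n) = 0"
  shows "cinner f g = 0"
proof -
  have "riesz g = 0"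
  proof (rule eq_zero_of_cinner_zpow)
    fix n show "cinner (riesz g) (zpow n) = 0"
    proof (cases "0 \<le> n")
      case True
      then show ?thesis using g by (simp add: cinner_riesz_left H2_zpow)
    next
      case False
      then show ?thesis using riesz_in_H2[of g] unfolding H2_def by simp
    qed
  qed
  then show ?thesis using cinner_riesz_right[OF f, of g] by simp
qed

section \<open>Inner functions and model spaces\<close>

lemma inner_function_unimodular: "inner_function \<theta> \<Longrightarrow> unimodular \<theta>"
  by (simp add: inner_function_def)

lemma inner_function_Linf: "inner_function \<theta> \<Longrightarrow> \<theta> \<in> Linf"
  by (simp add: inner_function_def unimodular_imp_Linf)

lemma Linf_left_commute: "a \<in> Linf \<Longrightarrow> b \<in> Linf \<Longrightarrow> a \<odot> (b \<odot> x) = b \<odot> (a \<odot> x)"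
  by (simp add: Linf_mult_assoc mult_L2_commute)

text \<open>Moving \<theta> across gives <f, conj(\<theta>) z^n>. For m nonnegative the m-th
  coefficient of conj(\<theta>) z^n is the conjugate of the coefficient of \<theta> at n - m, which
  is 0 since n is negative.\<close>

lemma inner_mult_H2:
  assumes \<theta>: "inner_function \<theta>" and f: "f \<in> H2"
  shows "\<theta> \<odot> f \<in> H2"
  unfolding H2_def mem_Collect_eq
proof (intro allI impI)
  fix n :: int assume n: "n < 0"
  note L = inner_function_Linf[OF \<theta>]
  have "cinner f (conj_L2 \<theta> \<odot> zpow n) = 0"
  proof (rule cinner_H2_eq_zero[OF f])
    fix m :: int assume "0 \<le> m"
    then have "cinner \<theta> (zpow (n - m)) = 0" using \<theta> n by (simp add: inner_function_def H2_def)
    moreover have "cinner (conj_L2 \<theta> \<odot> zpow n) (zpow m) = cnj (cinner \<theta> (zpow (n - m)))"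
    proof -
      have "cinner (conj_L2 \<theta> \<odot> zpow n) (zpow m) = cinner (zpow n) (\<theta> \<odot> zpow m)"
        by (simp add: cinner_mult_left L Linf_conj)
      also have "\<dots> = cinner (zpow n) (zpow m \<odot> \<theta>)" by (simp add: mult_L2_commute)
      also have "\<dots> = cinner (zpow (n - m)) \<theta>"
        by (simp add: cinner_mult_right Linf_zpow conj_zpow zpow_add)
      finally show ?thesis by (metis cinner_commute)
    qed
    ultimately show "cinner (conj_L2 \<theta> \<odot> zpow n) (zpow m) = 0" by simp
  qed
  then show "cinner (\<theta> \<odot> f) (zpow n) = 0" by (simp add: cinner_mult_left L)
qed

lemma model_space_diff: "x \<in> model_space \<theta> \<Longrightarrow> y \<in> model_space \<theta> \<Longrightarrow> x - y \<in> model_space \<theta>"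
  by (simp add: model_space_def H2_diff cinner_diff_left)

lemma model_space_H2: "x \<in> model_space \<theta> \<Longrightarrow> x \<in> H2"
  by (simp add: model_space_def)

lemma model_space_cinner: "x \<in> model_space \<theta> \<Longrightarrow> g \<in> H2 \<Longrightarrow> cinner x (\<theta> \<odot> g) = 0"
  by (simp add: model_space_def)

definition model_proj :: "L2 \<Rightarrow> L2 \<Rightarrow> L2" where
  "model_proj \<theta> x = riesz x - \<theta> \<odot> riesz (conj_L2 \<theta> \<odot> x)"

text \<open>Both summands of \<open>model_proj\<close> pair with \<theta> g to <x, \<theta> g>: the
  first since \<theta> g lies in \<open>H2\<close>, the second since \<theta> is unimodular.\<close>

lemma model_proj_in_model_space:
  assumes \<theta>: "inner_function \<theta>"
  shows "model_proj \<theta> x \<in> model_space \<theta>"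
proof -
  note L = inner_function_Linf[OF \<theta>]
  have "cinner (model_proj \<theta> x) (\<theta> \<odot> g) = 0" if "g \<in> H2" for g
    using that inner_function_unimodular[OF \<theta>]
    by (simp add: model_proj_def cinner_diff_left cinner_riesz_left inner_mult_H2[OF \<theta>]
        cinner_mult_left[OF L] unimodular_conj_mult_cancel)
      (simp add: cinner_mult_right[OF L])
  then show ?thesis by (auto simp: model_space_def model_proj_def H2_diff inner_mult_H2[OF \<theta>])
qed

lemma cinner_model_proj:
  assumes \<theta>: "inner_function \<theta>" and v: "v \<in> model_space \<theta>"
  shows "cinner (model_proj \<theta> x) v = cinner x v"
proof -
  have "cinner (\<theta> \<odot> riesz (conj_L2 \<theta> \<odot> x)) v = 0"
    using model_space_cinner[OF v riesz_in_H2] by (subst cinner_commute) simp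
  then show ?thesis
    by (simp add: model_proj_def cinner_diff_left cinner_riesz_left model_space_H2[OF v])
qed

lemma orth_proj_model_space:
  "inner_function \<theta> \<Longrightarrow> orth_proj (model_space \<theta>) x = model_proj \<theta> x"
  by (intro orth_proj_eqI model_space_diff)
    (simp_all add: model_proj_in_model_space cinner_diff_left cinner_model_proj)

section \<open>Explicit formulas for the shifts and their adjoints\<close>

lemma backward_shift_eq: "backward_shift f = riesz (zpow (- 1) \<odot> f)"
  unfolding backward_shift_def
  by (intro adjoint_op_eqI H2_diff) (simp_all add: shift_def cinner_zpow_mult_left cinner_riesz_right)

text \<open>\<theta>H^2 is invariant under z, so the model space is invariant under S^*; the adjoint
  of the compressed shift is therefore the restriction of S^*.\<close>

lemma model_shift_adj_eq:
  assumes \<theta>: "inner_function \<theta>" and k: "k \<in> model_space \<theta>"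
  shows "model_shift_adj \<theta> k = riesz (zpow (- 1) \<odot> k)"
  unfolding model_shift_adj_def
proof (intro adjoint_op_eqI model_space_diff)
  have "cinner (riesz (zpow (- 1) \<odot> k)) (\<theta> \<odot> g) = 0" if g: "g \<in> H2" for g
  proof -
    have "cinner (riesz (zpow (- 1) \<odot> k)) (\<theta> \<odot> g) = cinner k (\<theta> \<odot> (zvar \<odot> g))"
      using Linf_left_commute[OF Linf_zpow inner_function_Linf[OF \<theta>]]
      by (simp add: cinner_riesz_left inner_mult_H2[OF \<theta> g] cinner_zpow_mult_left)
    then show ?thesis using model_space_cinner[OF k H2_zpow_mult[OF _ g]] by simp
  qed
  then show "riesz (zpow (- 1) \<odot> k) \<in> model_space \<theta>" by (auto simp: model_space_def)
  fix v assume "v \<in> model_space \<theta>"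
  then show "cinner (model_shift \<theta> v) k = cinner v (riesz (zpow (- 1) \<odot> k))"
    by (simp add: model_shift_def orth_proj_model_space[OF \<theta>] cinner_model_proj[OF \<theta> k]
        shift_def cinner_zpow_mult_left cinner_riesz_right model_space_H2)
qed

text \<open>z commutes past \<eta>, so z \<eta> f already lies in \<eta>H^2 and is its own
  projection.\<close>

lemma restricted_shift_eq:
  assumes \<eta>: "inner_function \<eta>" and f: "f \<in> H2"
  shows "restricted_shift \<eta> (\<eta> \<odot> f) = \<eta> \<odot> (zvar \<odot> f)"
proof -
  have "zvar \<odot> (\<eta> \<odot> f) = \<eta> \<odot> (zvar \<odot> f)"
    by (rule Linf_left_commute[OF Linf_zpow inner_function_Linf[OF \<eta>]])
  moreover have "\<eta> \<odot> (zvar \<odot> f) \<in> (\<odot>) \<eta> ` H2" using f by (intro imageI H2_zpow_mult) simp_all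
  moreover have "x - y \<in> (\<odot>) \<eta> ` H2" if "x \<in> (\<odot>) \<eta> ` H2" "y \<in> (\<odot>) \<eta> ` H2" for x y
    using that by (auto simp: Linf_mult_diff[OF inner_function_Linf[OF \<eta>], symmetric] intro!: imageI H2_diff)
  ultimately show ?thesis
    unfolding restricted_shift_def shift_def by (intro orth_proj_eqI) simp_all
qed

section \<open>The displacement identity and its converse\<close>

lemma riesz_zpow_riesz: "riesz (zpow (- 1) \<odot> riesz (zvar \<odot> x)) = riesz x"
  by (rule riesz_eqI)
    (simp_all add: cinner_zpow_mult_left cinner_riesz_left H2_zpow_mult)

text \<open>Multiplication by z carries exactly one mode, that of index -1, into \<open>H2\<close>,
  where it becomes the constant term.\<close>

lemma riesz_zvar_mult: "riesz (zvar \<odot> x) = zvar \<odot> riesz x + cinner (zvar \<odot> x) (zpow 0) *\<^sub>C zpow 0"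
proof (rule riesz_eqI)
  show "zvar \<odot> riesz x + cinner (zvar \<odot> x) (zpow 0) *\<^sub>C zpow 0 \<in> H2"
    by (intro H2_add H2_scaleC H2_zpow_mult H2_zpow) simp_all
  fix h assume h: "h \<in> H2"
  let ?c = "cinner h (zpow 0)"
  \<comment> \<open>z^(-1) h with its only possible negative mode removed: this lies in
    \<open>H2\<close>, so x - P x is orthogonal to it.\<close>
  define h' where "h' = zpow (- 1) \<odot> h - ?c *\<^sub>C zpow (- 1)"
  have "h' \<in> H2"
    unfolding H2_def mem_Collect_eq
  proof (intro allI impI)
    fix n :: int assume "n < 0"
    then show "cinner h' (zpow n) = 0"
      using h by (cases "n = -1") (simp_all add: h'_def H2_def cinner_diff_left cinner_zpow_mult_left
          zpow_add cinner_zpow)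
  qed
  then have "cinner (x - riesz x) h' = 0" using riesz_spec by blast
  moreover have "cinner (riesz x) (zpow (- 1)) = 0" using riesz_in_H2[of x] by (simp add: H2_def)
  ultimately have "cinner (x - riesz x) (zpow (- 1) \<odot> h) = cnj ?c * cinner x (zpow (- 1))"
    by (simp add: h'_def cinner_diff_left cinner_diff_right)
  moreover have "cinner (zvar \<odot> x) (zpow 0) = cinner x (zpow (- 1))"
    by (simp add: cinner_zpow_mult_left zpow_add)
  moreover have "cinner (zpow 0) h = cnj ?c" by (rule cinner_commute)
  ultimately show "cinner (zvar \<odot> x) h =
      cinner (zvar \<odot> riesz x + cinner (zvar \<odot> x) (zpow 0) *\<^sub>C zpow 0) h"
    by (simp add: cinner_add_left cinner_zpow_mult_left cinner_diff_left algebra_simps)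
qed

text \<open>The terms from P cancel by \<open>riesz_zpow_riesz\<close>. In the \<theta> part the two
  copies of \<theta> r cancel, and the constant from \<open>riesz_zvar_mult\<close>, multiplied by
  \<theta>, leaves c S^*(\<theta>).\<close>

lemma model_proj_displacement:
  assumes \<theta>: "inner_function \<theta>"
  shows "model_proj \<theta> g - riesz (zpow (- 1) \<odot> model_proj \<theta> (zvar \<odot> g)) =
    cinner (zvar \<odot> g) \<theta> *\<^sub>C backward_shift \<theta>"
proof -
  note L = inner_function_Linf[OF \<theta>]
  define r where "r = riesz (conj_L2 \<theta> \<odot> g)"
  define c where "c = cinner (zvar \<odot> g) \<theta>"
  have c: "c = cinner (zvar \<odot> (conj_L2 \<theta> \<odot> g)) (zpow 0)"
  proof -
    \<comment> \<open>Writing \<theta> as \<theta> times 1 lets \<theta> move to the left, which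
      identifies c with the constant coefficient of z conj(\<theta>) g.\<close>
    have "c = cinner (zvar \<odot> g) (\<theta> \<odot> zpow 0)" by (simp add: c_def mult_L2_commute[of \<theta>])
    also have "\<dots> = cinner (conj_L2 \<theta> \<odot> (zvar \<odot> g)) (zpow 0)" by (rule cinner_mult_right[OF L])
    finally show ?thesis by (simp add: Linf_left_commute[OF Linf_conj[OF L] Linf_zpow])
  qed
  have "riesz (conj_L2 \<theta> \<odot> (zvar \<odot> g)) = zvar \<odot> r + c *\<^sub>C zpow 0"
    unfolding r_def c using riesz_zvar_mult by (simp add: Linf_left_commute[OF Linf_conj[OF L] Linf_zpow])
  then have "zpow (- 1) \<odot> model_proj \<theta> (zvar \<odot> g) =
      zpow (- 1) \<odot> riesz (zvar \<odot> g) - zpow (- 1) \<odot> (\<theta> \<odot> (zvar \<odot> r + c *\<^sub>C zpow 0))"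
    by (simp add: model_proj_def Linf_mult_diff Linf_zpow)
  also have "zpow (- 1) \<odot> (\<theta> \<odot> (zvar \<odot> r + c *\<^sub>C zpow 0)) = \<theta> \<odot> r + c *\<^sub>C (zpow (- 1) \<odot> \<theta>)"
    by (simp add: Linf_left_commute[OF Linf_zpow L] Linf_mult_add Linf_mult_scaleC Linf_zpow L zpow_add
        mult_L2_commute[of \<theta> "zpow _"])
  finally have "riesz (zpow (- 1) \<odot> model_proj \<theta> (zvar \<odot> g)) =
      riesz g - (\<theta> \<odot> r + c *\<^sub>C backward_shift \<theta>)"
    by (simp add: riesz_diff riesz_add riesz_scaleC riesz_zpow_riesz backward_shift_eq
        riesz_ident inner_mult_H2[OF \<theta>] r_def)
  then show ?thesis by (simp add: model_proj_def r_def c_def)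
qed

text \<open>This is \<open>model_proj_displacement\<close> for g = \<phi> \<eta> f. P is dropped
  against f in \<open>H2\<close>, and the conjugated factor moves over to give <z g,
  \<theta>>.\<close>

lemma restricted_toeplitz_displacement:
  assumes \<eta>: "inner_function \<eta>" and \<theta>: "inner_function \<theta>" and \<phi>: "\<phi> \<in> Linf"
  shows "displacement_identity \<eta> \<theta> (restricted_toeplitz \<theta> \<phi>) \<phi>"
  unfolding displacement_identity_def
proof
  fix f assume f: "f \<in> H2"
  note L = inner_function_Linf[OF \<theta>] inner_function_Linf[OF \<eta>] \<phi> Linf_zpow
  define g where "g = \<phi> \<odot> (\<eta> \<odot> f)"
  have zg: "\<phi> \<odot> (\<eta> \<odot> (zvar \<odot> f)) = zvar \<odot> g"
    by (simp add: g_def Linf_left_commute[OF Linf_zpow] L)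
  have "cinner f (riesz (\<theta> \<odot> conj_L2 (zvar \<odot> \<phi> \<odot> \<eta>))) =
      cinner f (conj_L2 (zvar \<odot> \<phi> \<odot> \<eta>) \<odot> \<theta>)"
    by (simp add: cinner_riesz_right f mult_L2_commute)
  also have "\<dots> = cinner ((zvar \<odot> \<phi> \<odot> \<eta>) \<odot> f) \<theta>"
    by (simp add: cinner_mult_left Linf_mult L)
  also have "(zvar \<odot> \<phi> \<odot> \<eta>) \<odot> f = zvar \<odot> g"
    by (simp add: g_def Linf_mult_assoc Linf_mult L)
  finally have c: "cinner f (riesz (\<theta> \<odot> conj_L2 (zvar \<odot> \<phi> \<odot> \<eta>))) = cinner (zvar \<odot> g) \<theta>" .
  show "restricted_toeplitz \<theta> \<phi> (\<eta> \<odot> f) -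
      model_shift_adj \<theta> (restricted_toeplitz \<theta> \<phi> (restricted_shift \<eta> (\<eta> \<odot> f))) =
      rank_one (backward_shift \<theta>) (riesz (\<theta> \<odot> conj_L2 (zvar \<odot> \<phi> \<odot> \<eta>))) f"
    using model_proj_displacement[OF \<theta>, of g]
    by (simp add: restricted_shift_eq[OF \<eta> f] restricted_toeplitz_def orth_proj_model_space[OF \<theta>]
        zg g_def[symmetric] model_shift_adj_eq[OF \<theta>] model_proj_in_model_space[OF \<theta>] rank_one_def c)
qed

text \<open>\<open>A\<close> is a Toeplitz operator with range in the model space, hence zero: the pairing
  \<open>\<langle>Af, g\<rangle> = \<langle>A(z\<^sup>n f), z\<^sup>n g\<rangle>\<close> only sees the part of \<open>z\<^sup>n g\<close> outside \<open>\<theta>H\<^sup>2\<close>, whose norm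
  tends to zero because \<open>\<theta>\<close> is unimodular.\<close>

lemma toeplitz_into_model_space_eq_zero:
  assumes \<theta>: "inner_function \<theta>"
    and A: "\<And>f. f \<in> H2 \<Longrightarrow> A f \<in> model_space \<theta>"
    and shift: "\<And>f g. f \<in> H2 \<Longrightarrow> g \<in> H2 \<Longrightarrow> cinner (A f) g = cinner (A (zvar \<odot> f)) (zvar \<odot> g)"
    and bound: "\<And>f. f \<in> H2 \<Longrightarrow> norm (A f) \<le> C * norm f"
    and f: "f \<in> H2"
  shows "A f = 0"
proof -
  note U = inner_function_unimodular[OF \<theta>]
  \<comment> \<open>Testing A f against itself: the pairing is shown to be 0 and equals the squared
    norm.\<close>
  define g where "g = A f"
  have g: "g \<in> H2" unfolding g_def by (rule model_space_H2[OF A[OF f]])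
  have iter: "cinner (A f) g = cinner (A (zpow (int n) \<odot> f)) (zpow (int n) \<odot> g)" for n
  proof (induction n)
    case (Suc n)
    then show ?case
      using shift[OF H2_zpow_mult[OF _ f] H2_zpow_mult[OF _ g], of "int n" "int n"] by simp
  qed simp
  have "cmod (cinner (A f) g) \<le> 0 + e" if "e > 0" for e
  proof -
    \<comment> \<open>Multiplication by z^n is isometric, so this bounds the norm of A(z^n f) for
      every n. The added 1 keeps the divisor positive.\<close>
    have K: "0 < \<bar>C\<bar> * norm f + 1" by (simp add: add_nonneg_pos)
    then obtain n y where y: "y \<in> H2"
      and d: "norm (zpow (int n) \<odot> (conj_L2 \<theta> \<odot> g) - y) < e / (\<bar>C\<bar> * norm f + 1)"
      using zpow_mult_near_H2 \<open>e > 0\<close> divide_pos_pos by metis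
    let ?r = "zpow (int n) \<odot> (conj_L2 \<theta> \<odot> g) - y"
    let ?f = "zpow (int n) \<odot> f"
    have fn: "?f \<in> H2" by (intro H2_zpow_mult f) simp
    \<comment> \<open>Thus z^n g = \<theta> y + \<theta> r with r the small remainder, and \<theta>
      y is orthogonal to the range of A.\<close>
    have "\<theta> \<odot> (zpow (int n) \<odot> (conj_L2 \<theta> \<odot> g)) = zpow (int n) \<odot> g"
      by (simp only: Linf_left_commute[OF unimodular_imp_Linf[OF U] Linf_zpow]
          unimodular_mult_conj_cancel[OF U])
    then have "cinner (A f) g = cinner (A ?f) (\<theta> \<odot> y) + cinner (A ?f) (\<theta> \<odot> ?r)"
      by (simp add: iter[of n] Linf_mult_diff unimodular_imp_Linf[OF U] cinner_diff_right)
    also have "\<dots> = cinner (A ?f) (\<theta> \<odot> ?r)" by (simp add: model_space_cinner[OF A[OF fn] y])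
    finally have "cmod (cinner (A f) g) \<le> norm (A ?f) * norm ?r"
      using norm_cinner_le[of "A ?f" "\<theta> \<odot> ?r"] by (simp add: norm_unimodular_mult[OF U])
    also have "\<dots> \<le> (\<bar>C\<bar> * norm f + 1) * (e / (\<bar>C\<bar> * norm f + 1))"
    proof (rule mult_mono)
      have "C * norm f \<le> \<bar>C\<bar> * norm f" by (intro mult_right_mono) auto
      then show "norm (A ?f) \<le> \<bar>C\<bar> * norm f + 1"
        using bound[OF fn] by (simp add: norm_unimodular_mult unimodular_zpow)
    qed (use d K in auto)
    also have "\<dots> = e" using K by simp
    finally show ?thesis by simp
  qed
  then have "cmod (cinner (A f) g) \<le> 0" by (rule field_le_epsilon)
  then show ?thesis by (simp add: g_def cinner_self)
qed

text \<open>The projection p of x satisfies |p|^2 = <x, p>, and Cauchy-Schwarz applies.\<close>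

lemma norm_model_proj_le:
  assumes \<theta>: "inner_function \<theta>"
  shows "norm (model_proj \<theta> x) \<le> norm x"
proof -
  let ?p = "model_proj \<theta> x"
  have "cinner x ?p = complex_of_real ((norm ?p)\<^sup>2)"
    using cinner_model_proj[OF \<theta> model_proj_in_model_space[OF \<theta>], of x x]
    by (simp only: cinner_self)
  then have "(norm ?p)\<^sup>2 = cmod (cinner x ?p)"
    by (simp only: norm_of_real abs_of_nonneg zero_le_power2)
  also have "\<dots> \<le> norm x * norm ?p" by (rule norm_cinner_le)
  finally have "norm ?p * norm ?p \<le> norm x * norm ?p" by (simp add: power2_eq_square)
  then show ?thesis by (cases "norm ?p = 0") (simp_all add: mult_le_cancel_right)
qed

text \<open>X and the Toeplitz operator obey the identity with the same right-hand side, so it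
  cancels in the difference and leaves A f = P(z^(-1) A(z f)). Pairing with g in \<open>H2\<close>
  gives the Toeplitz relation of \<open>toeplitz_into_model_space_eq_zero\<close>.\<close>

lemma displacement_identity_imp_toeplitz:
  assumes \<eta>: "inner_function \<eta>" and \<theta>: "inner_function \<theta>"
    and X: "bounded_operator ((\<odot>) \<eta> ` H2) (model_space \<theta>) X"
    and \<phi>: "\<phi> \<in> Linf" and disp: "displacement_identity \<eta> \<theta> X \<phi>"
    and h: "h \<in> (\<odot>) \<eta> ` H2"
  shows "X h = restricted_toeplitz \<theta> \<phi> h"
proof -
  define T where "T = restricted_toeplitz \<theta> \<phi>"
  define A where "A f = X (\<eta> \<odot> f) - T (\<eta> \<odot> f)" for f
  have XK: "X (\<eta> \<odot> f) \<in> model_space \<theta>" if "f \<in> H2" for f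
    using X that by (simp add: bounded_operator_def)
  have T: "T x = model_proj \<theta> (\<phi> \<odot> x)" for x
    by (simp add: T_def restricted_toeplitz_def orth_proj_model_space[OF \<theta>])
  have TK: "T x \<in> model_space \<theta>" for x by (simp add: T model_proj_in_model_space[OF \<theta>])
  obtain C where "\<forall>x\<in>(\<odot>) \<eta> ` H2. norm (X x) \<le> C * norm x"
    using X unfolding bounded_operator_def by (elim conjE exE)
  then have C: "norm (X (\<eta> \<odot> f)) \<le> C * norm (\<eta> \<odot> f)" if "f \<in> H2" for f
    using that by simp
  obtain D where D: "\<And>f. norm (\<phi> \<odot> f) \<le> D * norm f" using Linf_mult_bounded[OF \<phi>] by blast
  obtain f where f: "f \<in> H2" "h = \<eta> \<odot> f" using h by blast
  have "A f = 0"
  proof (rule toeplitz_into_model_space_eq_zero[OF \<theta>, where A = A and C = "C + D"])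
    fix f assume f: "f \<in> H2"
    show "A f \<in> model_space \<theta>" unfolding A_def by (intro model_space_diff XK TK f)
    have "norm (A f) \<le> norm (X (\<eta> \<odot> f)) + norm (T (\<eta> \<odot> f))"
      unfolding A_def by (rule norm_triangle_ineq4)
    also have "\<dots> \<le> C * norm (\<eta> \<odot> f) + D * norm (\<eta> \<odot> f)"
      unfolding T by (intro add_mono C f order_trans[OF norm_model_proj_le[OF \<theta>] D])
    finally show "norm (A f) \<le> (C + D) * norm f"
      by (simp add: norm_unimodular_mult inner_function_unimodular[OF \<eta>] distrib_right)
    fix g assume g: "g \<in> H2"
    have zf: "zvar \<odot> f \<in> H2" by (intro H2_zpow_mult f) simp
    have "X (\<eta> \<odot> f) - riesz (zpow (- 1) \<odot> X (\<eta> \<odot> (zvar \<odot> f))) =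
        T (\<eta> \<odot> f) - riesz (zpow (- 1) \<odot> T (\<eta> \<odot> (zvar \<odot> f)))"
      using bspec[OF disp[unfolded displacement_identity_def] f]
        bspec[OF restricted_toeplitz_displacement[OF \<eta> \<theta> \<phi>, unfolded displacement_identity_def] f]
      by (simp add: restricted_shift_eq[OF \<eta> f] T_def[symmetric]
          model_shift_adj_eq[OF \<theta>] XK[OF zf] TK)
    then have "A f = riesz (zpow (- 1) \<odot> X (\<eta> \<odot> (zvar \<odot> f))) -
        riesz (zpow (- 1) \<odot> T (\<eta> \<odot> (zvar \<odot> f)))"
      unfolding A_def diff_eq_eq by simp
    then have "A f = riesz (zpow (- 1) \<odot> A (zvar \<odot> f))"
      by (simp only: A_def Linf_mult_diff[OF Linf_zpow] riesz_diff)
    then have "cinner (A f) g = cinner (riesz (zpow (- 1) \<odot> A (zvar \<odot> f))) g" by simp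
    then show "cinner (A f) g = cinner (A (zvar \<odot> f)) (zvar \<odot> g)"
      by (simp add: cinner_riesz_left g cinner_zpow_mult_left)
  qed (rule f(1))
  then show ?thesis by (simp add: A_def T_def f)
qed

theorem theorem1p2:
  fixes \<eta> \<theta> :: L2 and X :: "L2 \<Rightarrow> L2"
  assumes "inner_function \<eta>" and "inner_function \<theta>"
    and "bounded_operator ((\<odot>) \<eta> ` H2) (model_space \<theta>) X"
  shows "((\<exists>\<phi>\<in>Linf. \<forall>h\<in>(\<odot>) \<eta> ` H2. X h = restricted_toeplitz \<theta> \<phi> h) \<longleftrightarrow>
           (\<exists>\<phi>\<in>Linf. displacement_identity \<eta> \<theta> X \<phi>)) \<and>
         (\<forall>\<phi>\<in>Linf. displacement_identity \<eta> \<theta> X \<phi> \<longrightarrow>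
           (\<forall>h\<in>(\<odot>) \<eta> ` H2. X h = restricted_toeplitz \<theta> \<phi> h))"
proof -
  have "displacement_identity \<eta> \<theta> X \<phi>"
    if "\<phi> \<in> Linf" and X: "\<forall>h\<in>(\<odot>) \<eta> ` H2. X h = restricted_toeplitz \<theta> \<phi> h" for \<phi>
  proof -
    \<comment> \<open>X is prescribed only on \<eta>H^2, so the shifted argument must be seen to lie
      there too.\<close>
    have "X (\<eta> \<odot> (zvar \<odot> f)) = restricted_toeplitz \<theta> \<phi> (\<eta> \<odot> (zvar \<odot> f))"
      if "f \<in> H2" for f
      using X H2_zpow_mult[OF _ that, of 1] by simp
    then show ?thesis
      using restricted_toeplitz_displacement[OF assms(1,2) \<open>\<phi> \<in> Linf\<close>] X
      unfolding displacement_identity_def by (simp add: restricted_shift_eq[OF assms(1)])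
  qed
  then show ?thesis using displacement_identity_imp_toeplitz[OF assms] by blast
qed

end
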